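(* Let $\alpha>0$ be a computable ordinal. If $f\in\mathbb{N}^{\mathbb{N}}$ is a $\Pi^0_{1+\alpha}$-singleton, then $f$ strongly relativizes $\Delta^0_{1+\alpha}$ (at every space $\mathcal{X}$).
   Context: A "space" is a recursively presented Polish metric space: a complete separable metric space with a dense sequence $(r_i)$ for which the relations $d(r_i,r_j)\le m/(k+1)$ and $d(r_i,r_j)<m/(k+1)$ are computable. It comes with an effective enumeration $N_s(\mathcal{X})$, $s\in\mathbb{N}$, of basic neighborhoods (balls with centers $r_i$ and rational radii). Examples are $\mathbb{N}$, $2^{\mathbb{N}}$, $\mathbb{N}^{\mathbb{N}}$ and finite products. Computable ordinals are those below $\omega_1^{\mathrm{ck}}$, the least ordinal that is not the order type of a computable wellordering on $\mathbb{N}$. Effective Borel classes on a space $\mathcal{X}$: $P\subseteq\mathcal{X}$ is $\Sigma^0_\alpha$ ($1\le\alpha<\omega_1^{\mathrm{ck}}$) if it has a computable Borel code of rank at most $\alpha$. Here a code of rank $1$ is a $c\in\mathbb{N}^{\mathbb{N}}$ with $c(0)=0$, coding the open set $\bigcup\{N_s(\mathcal{X}):(\exists n)\,c(n+1)=s+1\}$; a code of rank at most $\alpha>1$ is either a code of rank at most some $\beta<\alpha$, or a $c$ with $c(0)=1$ such that each $(c)_n:=(m\mapsto c(1+\langle n,m\rangle))$ is a code of rank at most some $\beta_n<\alpha$ (with $\langle\cdot,\cdot\rangle$ a computable pairing bijection), coding $\bigcup_n(\mathcal{X}\setminus P_n)$ where $P_n$ is coded by $(c)_n$. $\Pi^0_\alpha$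 sets are complements of $\Sigma^0_\alpha$ sets and $\Delta^0_\alpha=\Sigma^0_\alpha\cap\Pi^0_\alpha$. For $f\in\mathbb{N}^{\mathbb{N}}$, $\Sigma^0_\alpha(f)$ (resp. $\Pi^0_\alpha(f)$) consists of the $f$-sections $Q_f=\{x:Q(f,x)\}$ of $\Sigma^0_\alpha$ (resp. $\Pi^0_\alpha$) sets $Q\subseteq\mathbb{N}^{\mathbb{N}}\times\mathcal{X}$, and $\Delta^0_\alpha(f)=\Sigma^0_\alpha(f)\cap\Pi^0_\alpha(f)$. $f$ is a $\Pi^0_{\alpha}$-singleton if $\{f\}$ is a $\Pi^0_{\alpha}$ subset of $\mathbb{N}^{\mathbb{N}}$. $f$ strongly relativizes $\Delta^0_\alpha$ at $\mathcal{X}$ if every $\Delta^0_\alpha(f)$ set $P\subseteq\mathcal{X}$ equals $Q_f$ for some $\Delta^0_\alpha$ set $Q\subseteq\mathbb{N}^{\mathbb{N}}\times\mathcal{X}$; it strongly relativizes $\Delta^0_\alpha$ if this holds at every space $\mathcal{X}$. *)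

theory Defs
  imports "HOL-Analysis.Analysis" "HOL-Library.Nat_Bijection"
begin

section \<open>Computable functions and relations on the natural numbers\<close>

datatype recf =
    Zero | Succ | Proj nat
  | Comp recf "recf list"
  | PrimRec recf recf
  | Mu recf

text \<open>\<open>recf_eval p xs y\<close>: the partial recursive function with program \<open>p\<close> is defined at the
  argument list \<open>xs\<close> and has value \<open>y\<close> there.\<close>

inductive recf_eval :: "recf \<Rightarrow> nat list \<Rightarrow> nat \<Rightarrow> bool" where
  zero: "recf_eval Zero xs 0"
| succ: "recf_eval Succ [x] (Suc x)"
| proj: "i < length xs \<Longrightarrow> recf_eval (Proj i) xs (xs ! i)"
| comp: "list_all2 (\<lambda>q y. recf_eval q xs y) qs ys \<Longrightarrow> recf_eval p ys z \<Longrightarrow>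
    recf_eval (Comp p qs) xs z"
| primrec_0: "recf_eval p xs z \<Longrightarrow> recf_eval (PrimRec p q) (0 # xs) z"
| primrec_Suc: "recf_eval (PrimRec p q) (n # xs) y \<Longrightarrow> recf_eval q (n # y # xs) z \<Longrightarrow>
    recf_eval (PrimRec p q) (Suc n # xs) z"
| mu: "recf_eval p (n # xs) 0 \<Longrightarrow> (\<And>i. i < n \<Longrightarrow> \<exists>y>0. recf_eval p (i # xs) y) \<Longrightarrow>
    recf_eval (Mu p) xs n"
monos list_all2_mono

inductive_cases recf_evalE:
  "recf_eval Zero xs y"
  "recf_eval Succ xs y"
  "recf_eval (Proj i) xs y"
  "recf_eval (Comp p qs) xs y"
  "recf_eval (PrimRec p q) (0 # xs) y"
  "recf_eval (PrimRec p q) (Suc n # xs) y"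
  "recf_eval (Mu p) xs y"

lemma recf_eval_unique: "recf_eval p xs y \<Longrightarrow> recf_eval p xs y' \<Longrightarrow> y = y'"
proof (induction arbitrary: y' rule: recf_eval.induct)
  case zero
  then show ?case by (rule recf_evalE) simp
next
  case succ
  then show ?case by (rule recf_evalE) simp
next
  case proj
  from proj(2) show ?case by (rule recf_evalE) simp
next
  case (comp xs qs ys p z)
  from comp.prems obtain ys' where
    ys': "list_all2 (\<lambda>q y. recf_eval q xs y) qs ys'" and z: "recf_eval p ys' y'"
    by (rule recf_evalE)
  have "ys = ys'"
    using comp(1) ys'
    by (intro nth_equalityI) (auto simp: list_all2_conv_all_nth)
  with comp.IH z show ?case by blast
next
  case primrec_0
  from primrec_0.prems show ?case by (rule recf_evalE) (rule primrec_0.IH)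
next
  case (primrec_Suc p q n xs y z)
  from primrec_Suc.prems show ?case
    by (rule recf_evalE) (use primrec_Suc.IH in blast)
next
  case (mu p n xs)
  from mu.prems have 1: "recf_eval p (y' # xs) 0"
    and 2: "\<And>i. i < y' \<Longrightarrow> \<exists>y>0. recf_eval p (i # xs) y"
    by (auto elim: recf_evalE)
  from mu.IH(1) 2 have "\<not> n < y'" by blast
  moreover from mu.IH(2) 1 have "\<not> y' < n" by blast
  ultimately show ?case by simp
qed

definition computable :: "(nat \<Rightarrow> nat) \<Rightarrow> bool" where
  "computable c \<longleftrightarrow> (\<exists>p. \<forall>n. recf_eval p [n] (c n))"

definition computable_rel :: "nat \<Rightarrow> (nat list \<Rightarrow> bool) \<Rightarrow> bool" where
  "computable_rel k R \<longleftrightarrow>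
     (\<exists>p. \<forall>xs. length xs = k \<longrightarrow> recf_eval p xs (if R xs then 1 else 0))"


section \<open>Countable ordinals\<close>

text \<open>Well-orders in the sense of \<open>Well_order\<close> are reflexive and live on their field, which may be
  any set of natural numbers; so finite ordinals are included.\<close>

quotient_type cord = "nat rel" / partial: "\<lambda>r s. (r, s) \<in> ordIso"
proof (rule part_equivpI)
  show "\<exists>r::nat rel. (r, r) \<in> ordIso"
    by (rule exI[of _ "{}"]) (simp add: ordIso_reflexive)
  show "symp (\<lambda>r s::nat rel. (r, s) \<in> ordIso)"
    by (auto intro!: sympI ordIso_symmetric)
  show "transp (\<lambda>r s::nat rel. (r, s) \<in> ordIso)"
    by (auto intro!: transpI intro: ordIso_transitive)
qed

instantiation cord :: linorder
begin

lift_definition less_eq_cord :: "cord \<Rightarrow> cord \<Rightarrow> bool" is "\<lambda>r s. (r, s) \<in> ordLeq"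
  by (meson ordIso_ordLeq_trans ordIso_symmetric ordLeq_ordIso_trans)

lift_definition less_cord :: "cord \<Rightarrow> cord \<Rightarrow> bool" is "\<lambda>r s. (r, s) \<in> ordLess"
  by (meson ordIso_ordLess_trans ordIso_symmetric ordLess_ordIso_trans)

instance
proof
  fix x y z :: cord
  show "x < y \<longleftrightarrow> x \<le> y \<and> \<not> y \<le> x"
    by transfer (meson not_ordLess_ordLeq ordIso_iff_ordLeq ordLeq_iff_ordLess_or_ordIso
        ordLess_imp_ordLeq)
  show "x \<le> x"
    by transfer (simp add: ordIso_imp_ordLeq)
  show "x \<le> y \<Longrightarrow> y \<le> z \<Longrightarrow> x \<le> z"
    by transfer (rule ordLeq_transitive)
  show "x \<le> y \<Longrightarrow> y \<le> x \<Longrightarrow> x = y"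
    by transfer (simp add: ordIso_iff_ordLeq)
  show "x \<le> y \<or> y \<le> x"
    by transfer (meson ordIso_iff_ordLeq ordLeq_Well_order_simp ordLeq_total)
qed

end

instance cord :: wellorder
proof (rule wf_wellorderI)
  show "wf {(x::cord, y). x < y}"
  proof (rule wf_subset)
    show "wf (inv_image (ordLess :: nat rel rel) rep_cord)"
      by (intro wf_inv_image wf_ordLess)
    show "{(x::cord, y). x < y} \<subseteq> inv_image ordLess rep_cord"
      by (auto simp: less_cord.rep_eq)
  qed
qed intro_classes

text \<open>Ordinal addition: a copy of \<open>s\<close> placed after a copy of \<open>r\<close>.\<close>

definition wo_sum :: "nat rel \<Rightarrow> nat rel \<Rightarrow> nat rel" where
  "wo_sum r s =
     {(sum_encode (Inl a), sum_encode (Inl b)) |a b. (a, b) \<in> r} \<union>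
     {(sum_encode (Inr a), sum_encode (Inr b)) |a b. (a, b) \<in> s} \<union>
     {(sum_encode (Inl a), sum_encode (Inr b)) |a b. a \<in> Field r \<and> b \<in> Field s}"

lemma Field_iff: "x \<in> Field r \<longleftrightarrow> (\<exists>y. (x, y) \<in> r \<or> (y, x) \<in> r)"
  by (auto simp: Field_def)

lemma wo_sum_iff:
  "(x, y) \<in> wo_sum r s \<longleftrightarrow>
    (case (sum_decode x, sum_decode y) of
       (Inl a, Inl b) \<Rightarrow> (a, b) \<in> r
     | (Inr a, Inr b) \<Rightarrow> (a, b) \<in> s
     | (Inl a, Inr b) \<Rightarrow> a \<in> Field r \<and> b \<in> Field s
     | (Inr a, Inl b) \<Rightarrow> False)"
proof -
  obtain u v where "x = sum_encode u" "y = sum_encode v"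
    by (metis sum_decode_inverse)
  then show ?thesis
    by (cases u; cases v) (auto simp: wo_sum_def sum_encode_eq)
qed

lemma Field_wo_sum_iff:
  "x \<in> Field (wo_sum r s) \<longleftrightarrow>
    (case sum_decode x of Inl a \<Rightarrow> a \<in> Field r | Inr b \<Rightarrow> b \<in> Field s)"
proof -
  obtain u where "x = sum_encode u"
    by (metis sum_decode_inverse)
  then show ?thesis
    unfolding Field_iff[of x]
    by (cases u) (fastforce simp: wo_sum_def sum_encode_eq Field_iff)+
qed

lemma Well_order_wo_sum:
  assumes r: "Well_order r" and s: "Well_order s"
  shows "Well_order (wo_sum r s)"
proof -
  let ?t = "wo_sum r s"
  note o = order_on_defs
  have "refl_on (Field ?t) ?t"
    using r s unfolding o
    by (auto simp: refl_on_def Field_wo_sum_iff wo_sum_iff split: sum.splits)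
  moreover have "?t \<subseteq> Field ?t \<times> Field ?t"
    by (auto simp: Field_def)
  moreover have "trans ?t"
  proof (rule transI)
    fix x y z assume "(x, y) \<in> ?t" "(y, z) \<in> ?t"
    then show "(x, z) \<in> ?t"
      using r s unfolding o
      by (auto simp: wo_sum_iff Field_def split: sum.splits dest: transD)
  qed
  moreover have "antisym ?t"
  proof (rule antisymI)
    fix x y assume xy: "(x, y) \<in> ?t" "(y, x) \<in> ?t"
    then have "sum_decode x = sum_decode y"
      using r s unfolding o
      by (auto simp: wo_sum_iff split: sum.splits dest: antisymD)
    then show "x = y"
      by (metis sum_decode_inverse)
  qed
  moreover have "total_on (Field ?t) ?t"
    unfolding total_on_def
  proof (intro ballI impI)
    fix x y assume *: "x \<in> Field ?t" "y \<in> Field ?t" "x \<noteq> y"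
    then have "sum_decode x \<noteq> sum_decode y"
      by (metis sum_decode_inverse)
    with * show "(x, y) \<in> ?t \<or> (y, x) \<in> ?t"
      using r s unfolding o total_on_def
      by (auto simp: wo_sum_iff Field_wo_sum_iff split: sum.splits)
  qed
  moreover have "wf (?t - Id)"
  proof (rule wfI_min)
    fix x Q assume x: "x \<in> (Q :: nat set)"
    show "\<exists>z\<in>Q. \<forall>y. (y, z) \<in> ?t - Id \<longrightarrow> y \<notin> Q"
    proof (cases "\<exists>a. sum_encode (Inl a) \<in> Q")
      case True
      then obtain a where a: "sum_encode (Inl a) \<in> Q"
        "\<And>b. (b, a) \<in> r - Id \<Longrightarrow> sum_encode (Inl b) \<notin> Q"
        using wfE_min[of "r - Id" _ "{a. sum_encode (Inl a) \<in> Q}"] r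
        unfolding well_order_on_def by (metis mem_Collect_eq)
      show ?thesis
      proof (intro bexI[OF _ a(1)] allI impI)
        fix y assume y: "(y, sum_encode (Inl a)) \<in> ?t - Id"
        then obtain b where b: "y = sum_encode (Inl b)" "(b, a) \<in> r"
          by (auto simp: wo_sum_def sum_encode_eq)
        with y have "(b, a) \<in> r - Id"
          by auto
        with a(2) b show "y \<notin> Q"
          by blast
      qed
    next
      case False
      then have "\<exists>a. sum_encode (Inr a) \<in> Q"
        by (metis x sum_decode_inverse sum.exhaust)
      then obtain a where a: "sum_encode (Inr a) \<in> Q"
        "\<And>b. (b, a) \<in> s - Id \<Longrightarrow> sum_encode (Inr b) \<notin> Q"
        using wfE_min[of "s - Id" _ "{a. sum_encode (Inr a) \<in> Q}"] s
        unfolding well_order_on_def by (metis mem_Collect_eq)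
      show ?thesis
      proof (intro bexI[OF _ a(1)] allI impI)
        fix y assume y: "(y, sum_encode (Inr a)) \<in> ?t - Id"
        then consider b where "y = sum_encode (Inl b)"
          | b where "y = sum_encode (Inr b)" "(b, a) \<in> s"
          by (auto simp: wo_sum_def sum_encode_eq)
        then show "y \<notin> Q"
        proof cases
          case 1
          with False show ?thesis by blast
        next
          case 2
          with y have "(b, a) \<in> s - Id" by auto
          with a(2) 2 show ?thesis by blast
        qed
      qed
    qed
  qed
  ultimately show ?thesis
    unfolding o by blast
qed

lemma ordIso_wo_sum:
  assumes "(r, r') \<in> ordIso" "(s, s') \<in> ordIso"
  shows "(wo_sum r s, wo_sum r' s') \<in> ordIso"
proof -
  from assms obtain f g where f: "iso r r' f" and g: "iso s s' g"
    and wo: "Well_order r" "Well_order r'" "Well_order s" "Well_order s'"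
    by (auto simp: ordIso_def)
  note f = f[unfolded iso_iff2] and g = g[unfolded iso_iff2]
  let ?h = "\<lambda>x. sum_encode (map_sum f g (sum_decode x))"
  have "inj_on ?h (Field (wo_sum r s))"
  proof (rule inj_onI)
    fix x y assume *: "x \<in> Field (wo_sum r s)" "y \<in> Field (wo_sum r s)" "?h x = ?h y"
    then have "map_sum f g (sum_decode x) = map_sum f g (sum_decode y)"
      by (simp add: sum_encode_eq)
    with * f g have "sum_decode x = sum_decode y"
      by (auto simp: Field_wo_sum_iff bij_betw_def inj_on_def split: sum.splits)
    then show "x = y"
      by (metis sum_decode_inverse)
  qed
  moreover have "?h ` Field (wo_sum r s) = Field (wo_sum r' s')"
  proof (intro set_eqI iffI)
    fix y assume "y \<in> ?h ` Field (wo_sum r s)"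
    with f g show "y \<in> Field (wo_sum r' s')"
      by (auto simp: Field_wo_sum_iff dest: bij_betw_apply split: sum.splits)
  next
    fix y assume y: "y \<in> Field (wo_sum r' s')"
    show "y \<in> ?h ` Field (wo_sum r s)"
    proof (cases "sum_decode y")
      case (Inl b)
      with y have "b \<in> Field r'" by (simp add: Field_wo_sum_iff)
      then obtain a where "a \<in> Field r" "b = f a"
        using f by (blast dest: bij_betw_imp_surj_on)
      with Inl show ?thesis
        by (intro image_eqI[of _ _ "sum_encode (Inl a)"])
           (auto simp: Field_wo_sum_iff dest: arg_cong[of _ _ sum_encode])
    next
      case (Inr b)
      with y have "b \<in> Field s'" by (simp add: Field_wo_sum_iff)
      then obtain a where "a \<in> Field s" "b = g a"
        using g by (blast dest: bij_betw_imp_surj_on)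
      with Inr show ?thesis
        by (intro image_eqI[of _ _ "sum_encode (Inr a)"])
           (auto simp: Field_wo_sum_iff dest: arg_cong[of _ _ sum_encode])
    qed
  qed
  moreover have "(x, y) \<in> wo_sum r s \<longleftrightarrow> (?h x, ?h y) \<in> wo_sum r' s'"
    if "x \<in> Field (wo_sum r s)" "y \<in> Field (wo_sum r s)" for x y
    using that f g
    by (auto simp: Field_wo_sum_iff wo_sum_iff bij_betw_def split: sum.splits)
  ultimately have "iso (wo_sum r s) (wo_sum r' s') ?h"
    unfolding iso_iff2 bij_betw_def by blast
  with wo show ?thesis
    unfolding ordIso_def by (auto intro: Well_order_wo_sum)
qed

instantiation cord :: "{zero, one, plus}"
begin

lift_definition zero_cord :: cord is "{}"
  by (simp add: ordIso_reflexive)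

lift_definition one_cord :: cord is "{(0, 0)}"
  by (rule ordIso_reflexive)
     (auto simp: order_on_defs refl_on_def Field_def trans_def antisym_def)

lift_definition plus_cord :: "cord \<Rightarrow> cord \<Rightarrow> cord" is wo_sum
  by (rule ordIso_wo_sum)

instance ..

end

lemma cord_zero_le: "(0::cord) \<le> \<alpha>"
  by transfer (auto simp: ordLeq_def embed_def Field_def bij_betw_def
      intro: ordIso_imp_ordLeq dest: ordIso_symmetric simp: ordIso_def)

lemma cord_zero_less_one: "(0::cord) < 1"
proof -
  have "(0::cord) \<noteq> 1"
    by transfer (auto simp: ordIso_def iso_iff2 bij_betw_def Field_def)
  with cord_zero_le show ?thesis by (simp add: less_le)
qed

lemma cord_less_one_iff: "\<alpha> < (1::cord) \<longleftrightarrow> \<alpha> = 0"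
proof
  show "\<alpha> < 1 \<Longrightarrow> \<alpha> = 0"
  proof transfer
    fix r :: "nat rel" assume "(r, r) \<in> ordIso" and *: "(r, {(0::nat, 0::nat)}) \<in> ordLess"
    have "Well_order r" "Well_order {(0::nat, 0::nat)}"
      using * unfolding ordLess_def by blast+
    with * obtain a where "a \<in> Field {(0::nat, 0::nat)}"
      "(r, Restr {(0, 0)} (underS {(0, 0)} a)) \<in> ordIso"
      by (auto simp: ordLess_iff_ordIso_Restr)
    moreover from this have "Restr {(0, 0)} (underS {(0, 0)} a) = {}"
      by (auto simp: Field_def underS_def)
    ultimately show "(r, {} :: nat rel) \<in> ordIso" by simp
  qed
qed (simp add: cord_zero_less_one)

definition computable_order_type :: "cord \<Rightarrow> bool" where
  "computable_order_type \<alpha> \<longleftrightarrow>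
     (\<exists>r. Well_order r \<and> computable_rel 2 (\<lambda>xs. (xs ! 0, xs ! 1) \<in> r) \<and> \<alpha> = abs_cord r)"

text \<open>\<open>\<alpha> < \<omega>\<^sub>1\<^sup>c\<^sup>k\<close>, where \<open>\<omega>\<^sub>1\<^sup>c\<^sup>k\<close> is the least ordinal that is not a computable order type.\<close>

definition computable_ordinal :: "cord \<Rightarrow> bool" where
  "computable_ordinal \<alpha> \<longleftrightarrow> (\<forall>\<beta>\<le>\<alpha>. computable_order_type \<beta>)"


section \<open>Recursively presented Polish metric spaces\<close>

record 'a pspace =
  metric_of :: "'a metric"
  dense_seq :: "nat \<Rightarrow> 'a"

abbreviation points :: "'a pspace \<Rightarrow> 'a set" where
  "points X \<equiv> mspace (metric_of X)"

definition recursively_presented :: "'a pspace \<Rightarrow> bool" where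
  "recursively_presented X \<longleftrightarrow>
     mcomplete_of (metric_of X) \<and>
     range (dense_seq X) \<subseteq> points X \<and>
     mtopology_of (metric_of X) closure_of range (dense_seq X) = points X \<and>
     computable_rel 4 (\<lambda>xs. mdist (metric_of X) (dense_seq X (xs ! 0)) (dense_seq X (xs ! 1))
       \<le> real (xs ! 2) / (real (xs ! 3) + 1)) \<and>
     computable_rel 4 (\<lambda>xs. mdist (metric_of X) (dense_seq X (xs ! 0)) (dense_seq X (xs ! 1))
       < real (xs ! 2) / (real (xs ! 3) + 1))"

definition nbhd :: "'a pspace \<Rightarrow> nat \<Rightarrow> 'a set" where
  "nbhd X s = (let (i, t) = prod_decode s; (m, k) = prod_decode t in
     mball_of (metric_of X) (dense_seq X i) (real m / (real k + 1)))"

definition baire_dist :: "(nat \<Rightarrow> nat) \<Rightarrow> (nat \<Rightarrow> nat) \<Rightarrow> real" where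
  "baire_dist x y = (if x = y then 0 else 1 / (1 + real (LEAST n. x n \<noteq> y n)))"

lemma Metric_space_baire_dist: "Metric_space UNIV baire_dist"
proof
  fix x y z :: "nat \<Rightarrow> nat"
  show "0 \<le> baire_dist x y"
    by (simp add: baire_dist_def)
  show "baire_dist x y = baire_dist y x"
    by (simp add: baire_dist_def eq_commute)
  show "baire_dist x y = 0 \<longleftrightarrow> x = y"
    by (auto simp: baire_dist_def add_nonneg_eq_0_iff)
  have "baire_dist x z \<le> max (baire_dist x y) (baire_dist y z)"
  proof (cases "x = y \<or> y = z \<or> x = z")
    case True
    then show ?thesis by (auto simp: baire_dist_def le_max_iff_disj)
  next
    case False
    define l where "l = (\<lambda>u v :: nat \<Rightarrow> nat. LEAST n. u n \<noteq> v n)"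
    have "x (l x z) \<noteq> z (l x z)"
      unfolding l_def by (rule LeastI_ex) (use False in auto)
    then have "x (l x z) \<noteq> y (l x z) \<or> y (l x z) \<noteq> z (l x z)"
      by auto
    then have "l x y \<le> l x z \<or> l y z \<le> l x z"
      unfolding l_def by (auto intro: Least_le)
    then have "1 / (1 + real (l x z)) \<le> 1 / (1 + real (l x y)) \<or>
               1 / (1 + real (l x z)) \<le> 1 / (1 + real (l y z))"
      by (auto intro!: divide_left_mono)
    with False show ?thesis
      by (auto simp: baire_dist_def l_def le_max_iff_disj)
  qed
  moreover have "max (baire_dist x y) (baire_dist y z) \<le> baire_dist x y + baire_dist y z"
    by (simp add: baire_dist_def)
  ultimately show "baire_dist x z \<le> baire_dist x y + baire_dist y z"
    by (rule order_trans)
qed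

text \<open>The dense sequence enumerates the eventually zero sequences.\<close>

definition baire :: "(nat \<Rightarrow> nat) pspace" where
  "baire = \<lparr> metric_of = metric (UNIV, baire_dist),
     dense_seq = (\<lambda>i n. let xs = list_decode i in if n < length xs then xs ! n else 0) \<rparr>"

text \<open>The product carries the maximum metric. The library's \<open>prod_metric\<close> is Euclidean, and its
  comparisons with rationals need not be decidable from those of the factors.\<close>

definition max_dist :: "'a metric \<Rightarrow> 'b metric \<Rightarrow> 'a \<times> 'b \<Rightarrow> 'a \<times> 'b \<Rightarrow> real" where
  "max_dist m1 m2 p q = max (mdist m1 (fst p) (fst q)) (mdist m2 (snd p) (snd q))"

lemma Metric_space_max_dist: "Metric_space (mspace m1 \<times> mspace m2) (max_dist m1 m2)"
proof -
  interpret m1: Metric_space "mspace m1" "mdist m1" by simp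
  interpret m2: Metric_space "mspace m2" "mdist m2" by simp
  show ?thesis
  proof
    fix p q r
    show "0 \<le> max_dist m1 m2 p q"
      by (simp add: max_dist_def le_max_iff_disj)
    show "max_dist m1 m2 p q = max_dist m1 m2 q p"
      by (simp add: max_dist_def m1.commute m2.commute)
    assume p: "p \<in> mspace m1 \<times> mspace m2" and q: "q \<in> mspace m1 \<times> mspace m2"
    have "max_dist m1 m2 p q = 0 \<longleftrightarrow>
        mdist m1 (fst p) (fst q) = 0 \<and> mdist m2 (snd p) (snd q) = 0"
      using m1.nonneg[of "fst p" "fst q"] m2.nonneg[of "snd p" "snd q"]
      unfolding max_dist_def by linarith
    also have "\<dots> \<longleftrightarrow> p = q"
      using p q by (auto simp: prod_eq_iff)
    finally show "max_dist m1 m2 p q = 0 \<longleftrightarrow> p = q" .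
    assume r: "r \<in> mspace m1 \<times> mspace m2"
    show "max_dist m1 m2 p r \<le> max_dist m1 m2 p q + max_dist m1 m2 q r"
      using p q r m1.triangle[of "fst p" "fst q" "fst r"] m2.triangle[of "snd p" "snd q" "snd r"]
      unfolding max_dist_def by (auto simp: mem_Times_iff)
  qed
qed

definition prod_pspace :: "'a pspace \<Rightarrow> 'b pspace \<Rightarrow> ('a \<times> 'b) pspace" where
  "prod_pspace X Y =
     \<lparr> metric_of = metric (points X \<times> points Y, max_dist (metric_of X) (metric_of Y)),
       dense_seq = (\<lambda>s. let (i, j) = prod_decode s in (dense_seq X i, dense_seq Y j)) \<rparr>"

lemma points_baire [simp]: "points baire = UNIV"
  by (simp add: baire_def Metric_space.mspace_metric[OF Metric_space_baire_dist])

lemma mdist_baire [simp]: "mdist (metric_of baire) = baire_dist"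
  by (simp add: baire_def Metric_space.mdist_metric[OF Metric_space_baire_dist])

lemma points_prod_pspace [simp]: "points (prod_pspace X Y) = points X \<times> points Y"
  by (simp add: prod_pspace_def Metric_space.mspace_metric[OF Metric_space_max_dist])

lemma mdist_prod_pspace [simp]:
  "mdist (metric_of (prod_pspace X Y)) = max_dist (metric_of X) (metric_of Y)"
  by (simp add: prod_pspace_def Metric_space.mdist_metric[OF Metric_space_max_dist])


section \<open>Effective Borel classes\<close>

definition subcode :: "(nat \<Rightarrow> nat) \<Rightarrow> nat \<Rightarrow> nat \<Rightarrow> nat" where
  "subcode c n = (\<lambda>m. c (1 + prod_encode (n, m)))"

text \<open>\<open>borel_code X \<alpha> c P\<close>: \<open>c\<close> is a Borel code of rank at most \<open>\<alpha>\<close> for the subset \<open>P\<close> of \<open>X\<close>.\<close>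

inductive borel_code :: "'a pspace \<Rightarrow> cord \<Rightarrow> (nat \<Rightarrow> nat) \<Rightarrow> 'a set \<Rightarrow> bool" for X where
  open_code: "c 0 = 0 \<Longrightarrow> borel_code X 1 c (\<Union>{nbhd X s |s. \<exists>n. c (n + 1) = s + 1})"
| weaken: "borel_code X \<beta> c P \<Longrightarrow> \<beta> < \<alpha> \<Longrightarrow> borel_code X \<alpha> c P"
| union_compl: "1 < \<alpha> \<Longrightarrow> c 0 = 1 \<Longrightarrow> (\<And>n. \<exists>\<beta><\<alpha>. borel_code X \<beta> (subcode c n) (P n)) \<Longrightarrow>
    borel_code X \<alpha> c (\<Union>n. points X - P n)"

lemma borel_code_unique: "borel_code X \<alpha> c P \<Longrightarrow> borel_code X \<beta> c Q \<Longrightarrow> P = Q"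
proof (induction arbitrary: \<beta> Q rule: borel_code.induct)
  case (open_code c)
  from open_code(2,1) show ?case
    by (induction rule: borel_code.induct) auto
next
  case (weaken \<gamma> c P \<alpha>)
  then show ?case by blast
next
  case (union_compl \<alpha> c P)
  from union_compl(4,2,3) show ?case
  proof (induction rule: borel_code.induct)
    case (union_compl \<alpha>' c P')
    have "P n = P' n" for n
      using union_compl(3)[of n] union_compl(5)[of n] by blast
    then show ?case by simp
  qed auto
qed

definition Sigma0 :: "'a pspace \<Rightarrow> cord \<Rightarrow> 'a set set" where
  "Sigma0 X \<alpha> = {P. \<exists>c. computable c \<and> borel_code X \<alpha> c P}"

definition Pi0 :: "'a pspace \<Rightarrow> cord \<Rightarrow> 'a set set" where
  "Pi0 X \<alpha> = {points X - P |P. P \<in> Sigma0 X \<alpha>}"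

definition Delta0 :: "'a pspace \<Rightarrow> cord \<Rightarrow> 'a set set" where
  "Delta0 X \<alpha> = Sigma0 X \<alpha> \<inter> Pi0 X \<alpha>"

definition section_at :: "'b \<Rightarrow> ('b \<times> 'a) set \<Rightarrow> 'a set" where
  "section_at f Q = {x. (f, x) \<in> Q}"

definition Sigma0_in :: "(nat \<Rightarrow> nat) \<Rightarrow> 'a pspace \<Rightarrow> cord \<Rightarrow> 'a set set" where
  "Sigma0_in f X \<alpha> = section_at f ` Sigma0 (prod_pspace baire X) \<alpha>"

definition Pi0_in :: "(nat \<Rightarrow> nat) \<Rightarrow> 'a pspace \<Rightarrow> cord \<Rightarrow> 'a set set" where
  "Pi0_in f X \<alpha> = section_at f ` Pi0 (prod_pspace baire X) \<alpha>"

definition Delta0_in :: "(nat \<Rightarrow> nat) \<Rightarrow> 'a pspace \<Rightarrow> cord \<Rightarrow> 'a set set" where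
  "Delta0_in f X \<alpha> = Sigma0_in f X \<alpha> \<inter> Pi0_in f X \<alpha>"

definition Pi0_singleton :: "cord \<Rightarrow> (nat \<Rightarrow> nat) \<Rightarrow> bool" where
  "Pi0_singleton \<alpha> f \<longleftrightarrow> {f} \<in> Pi0 baire \<alpha>"

definition strongly_relativizes_Delta0_at :: "(nat \<Rightarrow> nat) \<Rightarrow> cord \<Rightarrow> 'a pspace \<Rightarrow> bool" where
  "strongly_relativizes_Delta0_at f \<alpha> X \<longleftrightarrow>
     (\<forall>P\<in>Delta0_in f X \<alpha>. \<exists>Q\<in>Delta0 (prod_pspace baire X) \<alpha>. P = section_at f Q)"

end

theory Submission
  imports Defs
begin

text \<open>Let \<open>\<xi> = 1 + \<alpha> > 1\<close>, let \<open>S\<close> be the complement of \<open>{f}\<close>, and let \<open>A\<close> and \<open>B\<close> be \<open>\<Sigma>\<^sub>\<xi>\<close> sets whose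
  \<open>f\<close>-sections are \<open>P\<close> and its complement. Then \<open>A \<union> S \<times> X\<close> and \<open>B \<union> S \<times> X\<close> are \<open>\<Sigma>\<^sub>\<xi>\<close> sets with the same
  \<open>f\<close>-sections as \<open>A\<close> and \<open>B\<close>, and they cover the product space. Effective reduction, available since
  \<open>\<xi> > 1\<close>, shrinks them to complementary \<open>\<Sigma>\<^sub>\<xi>\<close> sets, that is, to a \<open>\<Delta>\<^sub>\<xi>\<close> set and its complement; the
  \<open>f\<close>-section of the former is still \<open>P\<close>.\<close>

section \<open>Closure properties of computable functions\<close>

definition recursive_on :: "nat \<Rightarrow> (nat list \<Rightarrow> nat) \<Rightarrow> bool" where
  "recursive_on k F \<longleftrightarrow> (\<exists>p. \<forall>xs. length xs = k \<longrightarrow> recf_eval p xs (F xs))"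

lemma recursive_on_cong:
  "recursive_on k F \<Longrightarrow> (\<And>xs. length xs = k \<Longrightarrow> F xs = G xs) \<Longrightarrow> recursive_on k G"
  unfolding recursive_on_def by metis

lemma recursive_on_nth: "i < k \<Longrightarrow> recursive_on k (\<lambda>xs. xs ! i)"
  unfolding recursive_on_def by (metis recf_eval.proj)

lemma recursive_on_map:
  assumes "recursive_on (length Gs) F" "\<forall>G\<in>set Gs. recursive_on k G"
  shows "recursive_on k (\<lambda>xs. F (map (\<lambda>G. G xs) Gs))"
proof -
  obtain p where p: "\<And>ys. length ys = length Gs \<Longrightarrow> recf_eval p ys (F ys)"
    using assms(1) unfolding recursive_on_def by blast
  obtain q where q: "\<And>G xs. G \<in> set Gs \<Longrightarrow> length xs = k \<Longrightarrow> recf_eval (q G) xs (G xs)"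
    using assms(2) unfolding recursive_on_def by metis
  have "recf_eval (Comp p (map q Gs)) xs (F (map (\<lambda>G. G xs) Gs))" if "length xs = k" for xs
    using q that
    by (intro recf_eval.comp[where ys = "map (\<lambda>G. G xs) Gs"] p) (auto simp: list_all2_conv_all_nth)
  then show ?thesis
    unfolding recursive_on_def by blast
qed

lemma recursive_on_rec_nat:
  assumes "recursive_on k F" "recursive_on (Suc (Suc k)) H"
  shows "recursive_on (Suc k) (\<lambda>ys. rec_nat (F (tl ys)) (\<lambda>n y. H (n # y # tl ys)) (hd ys))"
proof -
  obtain p where p: "\<And>xs. length xs = k \<Longrightarrow> recf_eval p xs (F xs)"
    using assms(1) unfolding recursive_on_def by blast
  obtain q where q: "\<And>xs. length xs = Suc (Suc k) \<Longrightarrow> recf_eval q xs (H xs)"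
    using assms(2) unfolding recursive_on_def by blast
  have "recf_eval (PrimRec p q) (n # xs) (rec_nat (F xs) (\<lambda>n y. H (n # y # xs)) n)"
    if "length xs = k" for n xs
    by (induction n) (use that p q in \<open>auto intro: recf_eval.primrec_0 recf_eval.primrec_Suc\<close>)
  then have "\<forall>ys. length ys = Suc k \<longrightarrow>
      recf_eval (PrimRec p q) ys (rec_nat (F (tl ys)) (\<lambda>n y. H (n # y # tl ys)) (hd ys))"
    by (auto simp: length_Suc_conv)
  then show ?thesis
    unfolding recursive_on_def by blast
qed

lemma recursive_on_zero: "recursive_on k (\<lambda>xs. 0)"
  unfolding recursive_on_def by (metis recf_eval.zero)

lemma recursive_on_one_Suc: "recursive_on (Suc 0) (\<lambda>xs. Suc (xs ! 0))"
  unfolding recursive_on_def by (rule exI[of _ Succ]) (auto simp: length_Suc_conv recf_eval.succ)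

lemma recursive_on_app1:
  "recursive_on (Suc 0) (\<lambda>xs. f (xs ! 0)) \<Longrightarrow> recursive_on k G \<Longrightarrow> recursive_on k (\<lambda>xs. f (G xs))"
  using recursive_on_map[of "[G]" "\<lambda>xs. f (xs ! 0)" k] by simp

lemma recursive_on_app2:
  "recursive_on 2 (\<lambda>xs. f (xs ! 0) (xs ! 1)) \<Longrightarrow> recursive_on k G \<Longrightarrow> recursive_on k H \<Longrightarrow>
    recursive_on k (\<lambda>xs. f (G xs) (H xs))"
  using recursive_on_map[of "[G, H]" "\<lambda>xs. f (xs ! 0) (xs ! 1)" k] by (simp add: numeral_2_eq_2)

lemma recursive_on_Suc: "recursive_on k G \<Longrightarrow> recursive_on k (\<lambda>xs. Suc (G xs))"
  by (rule recursive_on_app1[OF recursive_on_one_Suc])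

lemma recursive_on_rec_nat_binary:
  assumes "recursive_on 1 (\<lambda>xs. a (xs ! 0))" "recursive_on 3 (\<lambda>xs. h (xs ! 2) (xs ! 0) (xs ! 1))"
    and "recursive_on k G" "recursive_on k H"
  shows "recursive_on k (\<lambda>xs. rec_nat (a (H xs)) (h (H xs)) (G xs))"
proof -
  have "recursive_on 2 (\<lambda>ys. rec_nat (a (tl ys ! 0))
      (\<lambda>n y. h ((n # y # tl ys) ! 2) ((n # y # tl ys) ! 0) ((n # y # tl ys) ! 1)) (hd ys))"
    using recursive_on_rec_nat[of 1, OF assms(1), of "\<lambda>xs. h (xs ! 2) (xs ! 0) (xs ! 1)"] assms(2)
    by (simp add: eval_nat_numeral)
  then have "recursive_on 2 (\<lambda>ys. rec_nat (a (ys ! 1)) (h (ys ! 1)) (ys ! 0))"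
    by (rule recursive_on_cong) (auto simp: eval_nat_numeral length_Suc_conv)
  then show ?thesis
    by (rule recursive_on_app2[where f = "\<lambda>x y. rec_nat (a y) (h y) x"]) (rule assms)+
qed

lemma recursive_on_add:
  assumes "recursive_on k G" "recursive_on k H"
  shows "recursive_on k (\<lambda>xs. G xs + H xs)"
proof -
  have "rec_nat y (\<lambda>_. Suc) x = x + y" for x y :: nat
    by (induction x) auto
  then show ?thesis
    using recursive_on_rec_nat_binary[of "\<lambda>y. y" "\<lambda>_ _. Suc", OF _ _ assms]
    by (simp add: recursive_on_nth recursive_on_Suc)
qed

lemma recursive_on_mult:
  assumes "recursive_on k G" "recursive_on k H"
  shows "recursive_on k (\<lambda>xs. G xs * H xs)"
proof -
  have "rec_nat 0 (\<lambda>_ z. z + y) x = x * y" for x y :: nat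
    by (induction x) auto
  then show ?thesis
    using recursive_on_rec_nat_binary[of "\<lambda>_. 0" "\<lambda>y _ z. z + y", OF _ _ assms]
    by (simp add: recursive_on_nth recursive_on_add recursive_on_zero)
qed

lemma recursive_on_pred:
  assumes "recursive_on k G"
  shows "recursive_on k (\<lambda>xs. G xs - 1)"
proof -
  have "rec_nat 0 (\<lambda>n _. n) x = x - 1" for x :: nat
    by (induction x) auto
  then show ?thesis
    using recursive_on_rec_nat_binary[of "\<lambda>_. 0" "\<lambda>_ n _. n", OF _ _ assms assms]
    by (simp add: recursive_on_nth recursive_on_zero)
qed

lemma recursive_on_diff:
  assumes "recursive_on k G" "recursive_on k H"
  shows "recursive_on k (\<lambda>xs. G xs - H xs)"
proof -
  have "rec_nat y (\<lambda>_ z. z - 1) x = y - x" for x y :: nat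
    by (induction x) auto
  moreover have "recursive_on 3 (\<lambda>xs. xs ! 1 - 1)"
    by (rule recursive_on_pred) (simp add: recursive_on_nth)
  ultimately show ?thesis
    using recursive_on_rec_nat_binary[of "\<lambda>y. y" "\<lambda>_ _ z. z - 1", OF _ _ assms(2,1)]
    by (simp add: recursive_on_nth)
qed

lemma recursive_on_triangle:
  assumes "recursive_on k G"
  shows "recursive_on k (\<lambda>xs. triangle (G xs))"
proof -
  have "rec_nat 0 (\<lambda>n z. z + Suc n) x = triangle x" for x
    by (induction x) auto
  then show ?thesis
    using recursive_on_rec_nat_binary[of "\<lambda>_. 0" "\<lambda>_ n z. z + Suc n", OF _ _ assms assms]
    by (simp add: recursive_on_nth recursive_on_zero recursive_on_add recursive_on_Suc)
qed

lemma recursive_on_prod_encode: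
  "recursive_on k G \<Longrightarrow> recursive_on k H \<Longrightarrow> recursive_on k (\<lambda>xs. prod_encode (G xs, H xs))"
  unfolding prod_encode_def by (simp add: recursive_on_add recursive_on_triangle)

abbreviation pfst :: "nat \<Rightarrow> nat" where
  "pfst z \<equiv> fst (prod_decode z)"

abbreviation psnd :: "nat \<Rightarrow> nat" where
  "psnd z \<equiv> snd (prod_decode z)"

primrec diagonal :: "nat \<Rightarrow> nat" where
  "diagonal 0 = 0"
| "diagonal (Suc z) = diagonal z + (1 - (triangle (Suc (diagonal z)) - Suc z))"

lemma diagonal_bounds: "triangle (diagonal z) \<le> z \<and> z < triangle (Suc (diagonal z))"
proof (induction z)
  case (Suc z)
  then show ?case
    by (cases "triangle (Suc (diagonal z)) \<le> Suc z") (auto simp: Suc_diff_le)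
qed simp

lemma prod_decode_diagonal:
  "prod_decode z = (z - triangle (diagonal z), diagonal z - (z - triangle (diagonal z)))"
proof -
  have "prod_encode (z - triangle (diagonal z), diagonal z - (z - triangle (diagonal z))) = z"
    using diagonal_bounds[of z] by (simp add: prod_encode_def)
  then show ?thesis
    by (metis prod_encode_inverse)
qed

lemma recursive_on_diagonal:
  assumes "recursive_on k G"
  shows "recursive_on k (\<lambda>xs. diagonal (G xs))"
proof -
  have "rec_nat 0 (\<lambda>n z. z + ((Suc 0) - (triangle (Suc z) - Suc n))) x = diagonal x" for x
    by (induction x) auto
  moreover have "recursive_on 3 (\<lambda>xs. xs ! 1 + (Suc 0 - (triangle (Suc (xs ! 1)) - Suc (xs ! 0))))"
    by (intro recursive_on_add recursive_on_diff recursive_on_triangle recursive_on_Suc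
        recursive_on_zero recursive_on_nth) auto
  ultimately show ?thesis
    using recursive_on_rec_nat_binary[of "\<lambda>_. 0"
        "\<lambda>_ n z. z + (Suc 0 - (triangle (Suc z) - Suc n))", OF _ _ assms assms]
    by (simp add: recursive_on_zero)
qed

lemma recursive_on_pfst: "recursive_on k G \<Longrightarrow> recursive_on k (\<lambda>xs. pfst (G xs))"
  and recursive_on_psnd: "recursive_on k G \<Longrightarrow> recursive_on k (\<lambda>xs. psnd (G xs))"
  unfolding prod_decode_diagonal fst_conv snd_conv
  by (intro recursive_on_diff recursive_on_triangle recursive_on_diagonal; assumption)+

lemma computable_iff_recursive_on: "computable f \<longleftrightarrow> recursive_on (Suc 0) (\<lambda>xs. f (xs ! 0))"
proof
  show "computable f \<Longrightarrow> recursive_on (Suc 0) (\<lambda>xs. f (xs ! 0))"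
    unfolding computable_def recursive_on_def
    by (metis (no_types, lifting) One_nat_def length_0_conv length_Suc_conv nth_Cons_0)
  show "recursive_on (Suc 0) (\<lambda>xs. f (xs ! 0)) \<Longrightarrow> computable f"
    unfolding computable_def recursive_on_def
    by (metis length_Cons list.size(3) nth_Cons_0)
qed

lemma computable_comp: "computable f \<Longrightarrow> computable g \<Longrightarrow> computable (\<lambda>x. f (g x))"
  unfolding computable_iff_recursive_on by (rule recursive_on_app1)

lemma computable_const: "computable (\<lambda>x. c)"
proof (induction c)
  case 0
  then show ?case by (simp add: computable_iff_recursive_on recursive_on_zero)
next
  case (Suc c)
  then show ?case by (simp add: computable_iff_recursive_on recursive_on_Suc)
qed

lemma computable_id: "computable (\<lambda>x. x)"
  by (simp add: computable_iff_recursive_on recursive_on_nth)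

lemma computable_Suc: "computable f \<Longrightarrow> computable (\<lambda>x. Suc (f x))"
  by (simp add: computable_iff_recursive_on recursive_on_Suc)

lemma computable_add: "computable f \<Longrightarrow> computable g \<Longrightarrow> computable (\<lambda>x. f x + g x)"
  by (simp add: computable_iff_recursive_on recursive_on_add)

lemma computable_mult: "computable f \<Longrightarrow> computable g \<Longrightarrow> computable (\<lambda>x. f x * g x)"
  by (simp add: computable_iff_recursive_on recursive_on_mult)

lemma computable_diff: "computable f \<Longrightarrow> computable g \<Longrightarrow> computable (\<lambda>x. f x - g x)"
  by (simp add: computable_iff_recursive_on recursive_on_diff)

lemma computable_prod_encode:
  "computable f \<Longrightarrow> computable g \<Longrightarrow> computable (\<lambda>x. prod_encode (f x, g x))"
  by (simp add: computable_iff_recursive_on recursive_on_prod_encode)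

lemma computable_pfst: "computable f \<Longrightarrow> computable (\<lambda>x. pfst (f x))"
  by (simp add: computable_iff_recursive_on recursive_on_pfst)

lemma computable_psnd: "computable f \<Longrightarrow> computable (\<lambda>x. psnd (f x))"
  by (simp add: computable_iff_recursive_on recursive_on_psnd)

definition computable2 :: "(nat \<Rightarrow> nat \<Rightarrow> nat) \<Rightarrow> bool" where
  "computable2 D \<longleftrightarrow> computable (\<lambda>z. D (pfst z) (psnd z))"

definition computable3 :: "(nat \<Rightarrow> nat \<Rightarrow> nat \<Rightarrow> nat) \<Rightarrow> bool" where
  "computable3 D \<longleftrightarrow> computable (\<lambda>z. D (pfst z) (pfst (psnd z)) (psnd (psnd z)))"

lemma computable2_app:
  assumes "computable2 D" "computable f" "computable g"
  shows "computable (\<lambda>x. D (f x) (g x))"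
  using computable_comp[OF assms(1)[unfolded computable2_def] computable_prod_encode[OF assms(2,3)]]
  by simp

lemma computable3_app:
  assumes "computable3 D" "computable f" "computable g" "computable h"
  shows "computable (\<lambda>x. D (f x) (g x) (h x))"
  using computable_comp[OF assms(1)[unfolded computable3_def]
      computable_prod_encode[OF assms(2) computable_prod_encode[OF assms(3,4)]]]
  by simp

lemma computable_rec_nat:
  assumes "computable a" "computable3 h" "computable g"
  shows "computable (\<lambda>x. rec_nat (a x) (h x) (g x))"
proof -
  have "recursive_on 3 (\<lambda>xs. (\<lambda>z. h (pfst z) (pfst (psnd z)) (psnd (psnd z)))
      (prod_encode (xs ! 2, prod_encode (xs ! 0, xs ! 1))))"
    by (rule recursive_on_app1[OF assms(2)[unfolded computable3_def computable_iff_recursive_on]])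
       (intro recursive_on_prod_encode recursive_on_nth; simp)
  then have "recursive_on 3 (\<lambda>xs. h (xs ! 2) (xs ! 0) (xs ! 1))"
    by simp
  then show ?thesis
    using recursive_on_rec_nat_binary[of a h "Suc 0" "\<lambda>xs. g (xs ! 0)" "\<lambda>xs. xs ! 0"] assms(1,3)
    by (simp add: computable_iff_recursive_on recursive_on_nth)
qed

definition decidable :: "(nat \<Rightarrow> bool) \<Rightarrow> bool" where
  "decidable P \<longleftrightarrow> computable (\<lambda>x. of_bool (P x))"

definition decidable2 :: "(nat \<Rightarrow> nat \<Rightarrow> bool) \<Rightarrow> bool" where
  "decidable2 P \<longleftrightarrow> decidable (\<lambda>z. P (pfst z) (psnd z))"

lemma computable_if:
  assumes "decidable P" "computable f" "computable g"
  shows "computable (\<lambda>x. if P x then f x else g x)"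
proof -
  have "computable (\<lambda>x. of_bool (P x) * f x + (1 - of_bool (P x)) * g x)"
    by (intro computable_add computable_mult computable_diff computable_const assms(2,3)
        assms(1)[unfolded decidable_def])
  moreover have "(\<lambda>x. of_bool (P x) * f x + (1 - of_bool (P x)) * g x) =
      (\<lambda>x. if P x then f x else g x)"
    by auto
  ultimately show ?thesis by metis
qed

lemma decidable_le:
  assumes "computable f" "computable g"
  shows "decidable (\<lambda>x. f x \<le> g x)"
proof -
  have "computable (\<lambda>x. 1 - (f x - g x))"
    by (intro computable_diff computable_const assms)
  moreover have "(\<lambda>x. 1 - (f x - g x)) = (\<lambda>x. of_bool (f x \<le> g x))"
    by auto
  ultimately show ?thesis
    unfolding decidable_def by metis
qed

lemma decidable_less: "computable f \<Longrightarrow> computable g \<Longrightarrow> decidable (\<lambda>x. f x < g x)"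
  unfolding Suc_le_eq[symmetric] by (intro decidable_le computable_Suc)

lemma decidable_not:
  assumes "decidable P"
  shows "decidable (\<lambda>x. \<not> P x)"
proof -
  have "computable (\<lambda>x. 1 - of_bool (P x))"
    by (intro computable_diff computable_const assms[unfolded decidable_def])
  moreover have "(\<lambda>x. 1 - of_bool (P x)) = (\<lambda>x. of_bool (\<not> P x) :: nat)"
    by auto
  ultimately show ?thesis
    unfolding decidable_def by metis
qed

lemma decidable_conj: "decidable P \<Longrightarrow> decidable Q \<Longrightarrow> decidable (\<lambda>x. P x \<and> Q x)"
  unfolding decidable_def of_bool_conj by (rule computable_mult)

lemma decidable_disj: "decidable P \<Longrightarrow> decidable Q \<Longrightarrow> decidable (\<lambda>x. P x \<or> Q x)"
  using decidable_not[OF decidable_conj[OF decidable_not decidable_not]] by simp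

lemma decidable_imp: "decidable P \<Longrightarrow> decidable Q \<Longrightarrow> decidable (\<lambda>x. P x \<longrightarrow> Q x)"
  unfolding imp_conv_disj by (intro decidable_disj decidable_not)

lemma decidable_eq: "computable f \<Longrightarrow> computable g \<Longrightarrow> decidable (\<lambda>x. f x = g x)"
  unfolding order_eq_iff by (intro decidable_conj decidable_le)

lemma decidable_comp: "decidable P \<Longrightarrow> computable g \<Longrightarrow> decidable (\<lambda>x. P (g x))"
  unfolding decidable_def by (rule computable_comp)

lemma decidable2_app:
  "decidable2 P \<Longrightarrow> computable f \<Longrightarrow> computable g \<Longrightarrow> decidable (\<lambda>x. P (f x) (g x))"
  unfolding decidable2_def
  by (drule decidable_comp[OF _ computable_prod_encode]) auto

lemmas computable_intros =
  computable_const computable_id computable_Suc computable_add computable_mult computable_diff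
  computable_prod_encode computable_pfst computable_psnd computable_if
  decidable_le decidable_less decidable_not decidable_conj decidable_disj decidable_imp decidable_eq

lemma decidable_all_le:
  assumes P: "decidable2 P" and g: "computable g"
  shows "decidable (\<lambda>x. \<forall>j\<le>g x. P x j)"
proof -
  define h where "h = (\<lambda>x n y. of_bool (P x (Suc n)) * y :: nat)"
  have *: "rec_nat (of_bool (P x 0)) (h x) n = (of_bool (\<forall>j\<le>n. P x j) :: nat)" for x n
    by (induction n) (auto simp: h_def le_Suc_eq)
  have "computable (\<lambda>x. rec_nat (of_bool (P x 0)) (h x) (g x))"
    unfolding h_def
    by (intro computable_rec_nat g, unfold computable3_def decidable_def[symmetric])
       (intro computable_intros decidable2_app[OF P]
          decidable2_app[OF P, unfolded decidable_def])+
  then show ?thesis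
    unfolding * decidable_def .
qed

text \<open>Descending from \<open>x\<close> to \<open>0\<close> takes at most \<open>x\<close> steps, and \<open>f\<close> is recovered by walking
  the same path upwards.\<close>

lemma computable_descent:
  assumes zero: "f 0 = a" and suc: "\<And>n. f (Suc n) = h n (f (g n))" and le: "\<And>n. g n \<le> n"
    and g: "computable g" and h: "computable2 h"
  shows "computable f"
proof -
  define p where "p x k = rec_nat x (\<lambda>_ y. if y = 0 then 0 else g (y - 1)) k" for x k
  define v where "v x n y = (let z = p x (x - Suc n) in if z = 0 then a else h (z - 1) y)" for x n y
  have p_Suc: "p x (Suc k) = (if p x k = 0 then 0 else g (p x k - 1))" for x k
    by (simp add: p_def)
  have "p x k \<le> x - k" for x k
  proof (induction k)
    case (Suc k)
    then show ?case using le[of "p x k - 1"] by (auto simp: p_Suc)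
  qed (simp add: p_def)
  then have p_end: "p x x = 0" for x
    by (metis diff_self_eq_0 le_zero_eq)
  have v: "n \<le> x \<Longrightarrow> rec_nat a (v x) n = f (p x (x - n))" for x n
  proof (induction n)
    case 0
    then show ?case by (simp add: p_end zero)
  next
    case (Suc n)
    have "x - n = Suc (x - Suc n)"
      using Suc.prems by simp
    then have "rec_nat a (v x) (Suc n) = v x n (f (p x (Suc (x - Suc n))))"
      using Suc.IH Suc.prems by simp
    then show ?case
      by (cases "p x (x - Suc n)") (auto simp: v_def[of x n] Let_def p_Suc zero suc)
  qed
  have f: "f x = rec_nat a (v x) x" for x
    by (simp add: v) (simp add: p_def)
  have p: "computable2 p"
    unfolding computable2_def p_def
    by (intro computable_rec_nat, unfold computable3_def)
       (intro computable_intros computable_comp[OF g])+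
  show ?thesis
    unfolding f v_def Let_def
    by (intro computable_rec_nat, unfold computable3_def)
       (intro computable_intros computable2_app[OF h] computable2_app[OF p])+
qed

section \<open>Operations on Borel codes\<close>

definition coded_open :: "'a pspace \<Rightarrow> (nat \<Rightarrow> nat) \<Rightarrow> 'a set" where
  "coded_open X c = \<Union>{nbhd X s |s. \<exists>n. c (n + 1) = s + 1}"

lemma mem_coded_open: "x \<in> coded_open X c \<longleftrightarrow> (\<exists>n s. c (Suc n) = Suc s \<and> x \<in> nbhd X s)"
  unfolding coded_open_def by auto

lemma nbhd_subset_points: "nbhd X s \<subseteq> points X"
  unfolding nbhd_def mball_of_def Metric_space.mball_def[OF Metric_space_mspace_mdist]
  by (auto split: prod.splits)

lemma mem_nbhd_iff:
  assumes "range (dense_seq X) \<subseteq> points X"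
  shows "x \<in> nbhd X (prod_encode (i, prod_encode (m, k))) \<longleftrightarrow>
    x \<in> points X \<and> mdist (metric_of X) (dense_seq X i) x < real m / (real k + 1)"
  using assms unfolding nbhd_def mball_of_def Metric_space.mball_def[OF Metric_space_mspace_mdist]
  by auto

lemma borel_code_subset: "borel_code X \<beta> c P \<Longrightarrow> P \<subseteq> points X"
  by (induction rule: borel_code.induct) (auto dest: subsetD[OF nbhd_subset_points])

lemma Sigma0_subset_points: "A \<in> Sigma0 X \<alpha> \<Longrightarrow> A \<subseteq> points X"
  unfolding Sigma0_def using borel_code_subset by fast

lemma borel_code_rank_pos: "borel_code X \<beta> c P \<Longrightarrow> 1 \<le> \<beta>"
  by (induction rule: borel_code.induct) auto

lemma borel_code_mono: "borel_code X \<beta> c P \<Longrightarrow> \<beta> \<le> \<gamma> \<Longrightarrow> borel_code X \<gamma> c P"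
  by (auto simp: order_le_less intro: weaken)

lemma borel_code_coded_open: "c 0 = 0 \<Longrightarrow> 1 \<le> \<beta> \<Longrightarrow> borel_code X \<beta> c (coded_open X c)"
  unfolding coded_open_def by (rule borel_code_mono[OF open_code])

lemma borel_code_open_eq: "borel_code X \<beta> c P \<Longrightarrow> c 0 = 0 \<Longrightarrow> P = coded_open X c"
  using borel_code_unique borel_code_coded_open by blast

lemma borel_code_union_cases:
  assumes "borel_code X \<beta> c P" "c 0 \<noteq> 0"
  shows "1 < \<beta> \<and> c 0 = 1 \<and>
    (\<exists>Q. P = (\<Union>n. points X - Q n) \<and> (\<forall>n. \<exists>\<gamma><\<beta>. borel_code X \<gamma> (subcode c n) (Q n)))"
  using assms
proof (induction rule: borel_code.induct)
  case (weaken \<beta> c P \<alpha>)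
  have IH: "1 < \<beta>" "c 0 = 1" "\<exists>Q. P = (\<Union>n. points X - Q n) \<and>
      (\<forall>n. \<exists>\<gamma><\<beta>. borel_code X \<gamma> (subcode c n) (Q n))"
    using weaken.IH weaken.prems by auto
  from IH(3) obtain Q where P: "P = (\<Union>n. points X - Q n)"
    and Q: "\<forall>n. \<exists>\<gamma><\<beta>. borel_code X \<gamma> (subcode c n) (Q n)"
    by (elim exE conjE)
  have "\<forall>n. \<exists>\<gamma><\<alpha>. borel_code X \<gamma> (subcode c n) (Q n)"
    using Q weaken.hyps(2) by (meson order.strict_trans)
  with P have "\<exists>Q. P = (\<Union>n. points X - Q n) \<and>
      (\<forall>n. \<exists>\<gamma><\<alpha>. borel_code X \<gamma> (subcode c n) (Q n))"
    by (intro exI[of _ Q] conjI)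
  then show ?case
    using IH(1,2) weaken.hyps(2) by simp
next
  case (union_compl \<alpha> c P)
  then have "\<forall>n. \<exists>\<gamma><\<alpha>. borel_code X \<gamma> (subcode c n) (P n)"
    by blast
  then show ?case
    using union_compl.hyps(1,2) by (intro conjI exI[of _ P]) auto
qed auto

text \<open>The subset coded by \<open>shell_code X (Suc s) p\<close> is the complement of the closed ball concentric
  with \<open>nbhd X s\<close> whose radius is smaller by \<open>1 / ((k + 1) * (p + 1))\<close>, where \<open>m / (k + 1)\<close> is the
  radius of \<open>nbhd X s\<close>; it is the whole space if \<open>m = 0\<close>, or if the first argument is \<open>0\<close>,
  which stands for an entry that enumerates nothing.\<close>

definition far :: "'a pspace \<Rightarrow> nat \<Rightarrow> nat \<Rightarrow> nat \<Rightarrow> bool" where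
  "far X v p u \<longleftrightarrow> v = 0 \<or> (let s = v - 1; m = pfst (psnd s); k = psnd (psnd s); t = psnd u in
     m = 0 \<or> \<not> mdist (metric_of X) (dense_seq X (pfst s)) (dense_seq X (pfst u)) <
       real ((m * Suc p - 1) * Suc t + Suc k * Suc p) / (real (Suc k * Suc p * Suc t - 1) + 1))"

definition shell_code :: "'a pspace \<Rightarrow> nat \<Rightarrow> nat \<Rightarrow> nat \<Rightarrow> nat" where
  "shell_code X v p i = (if i = 0 then 0
     else if far X v p (i - 1) then Suc (prod_encode (pfst (i - 1), prod_encode (1, psnd (i - 1))))
     else 0)"

definition to_union :: "'a pspace \<Rightarrow> (nat \<Rightarrow> nat) \<Rightarrow> nat \<Rightarrow> nat" where
  "to_union X c i = (if c 0 \<noteq> 0 then c i else if i = 0 then 1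
     else shell_code X (c (Suc (pfst (pfst (i - 1))))) (psnd (pfst (i - 1))) (psnd (i - 1)))"

lemma subcode_to_union:
  "subcode (to_union X c) n =
    (if c 0 \<noteq> 0 then subcode c n else shell_code X (c (Suc (pfst n))) (psnd n))"
  by (auto simp: subcode_def to_union_def)

definition finite_union :: "'a pspace \<Rightarrow> nat \<Rightarrow> (nat \<Rightarrow> nat \<Rightarrow> nat) \<Rightarrow> nat \<Rightarrow> nat" where
  "finite_union X n D i = (if \<forall>j\<le>n. D j 0 = 0
     then if i = 0 then 0 else D (min (pfst (i - 1)) n) (Suc (psnd (i - 1)))
     else if i = 0 then 1
     else to_union X (D (min (pfst (pfst (i - 1))) n))
       (Suc (prod_encode (psnd (pfst (i - 1)), psnd (i - 1)))))"

definition component :: "nat \<Rightarrow> nat \<Rightarrow> nat" where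
  "component k m = pfst (rec_nat k (\<lambda>_ z. psnd z) m)"

lemma component_0: "component (prod_encode (a, k)) 0 = a"
  by (simp add: component_def)

lemma component_Suc: "component (prod_encode (a, k)) (Suc m) = component k m"
proof -
  have "rec_nat (prod_encode (a, k)) (\<lambda>_ z. psnd z) (Suc m) = rec_nat k (\<lambda>_ z. psnd z) m"
    by (induction m) auto
  then show ?thesis
    unfolding component_def by metis
qed

lemma ex_components: "\<exists>k. \<forall>m<n. component k m = s m"
proof (induction n arbitrary: s)
  case (Suc n)
  from Suc[of "\<lambda>m. s (Suc m)"] obtain k where "\<forall>m<n. component k m = s (Suc m)"
    by blast
  then have "\<forall>m<Suc n. component (prod_encode (s 0, k)) m = s m"
    by (auto simp: less_Suc_eq_0_disj component_0 component_Suc)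
  then show ?case by blast
qed simp

text \<open>If \<open>a\<close> and \<open>b\<close> code \<open>\<Union>\<^sub>n A n\<close> and \<open>\<Union>\<^sub>n B n\<close> as unions of complements of coded sets, the
  following codes \<open>\<Union>\<^sub>n A n - (\<Union>m<n+e. B m)\<close>. The complements of the \<open>B m\<close> are themselves unions
  of complements; intersecting finitely many of these unions amounts to choosing a member of
  each, which \<open>component k\<close> does.\<close>

definition reduct_family :: "'a pspace \<Rightarrow> (nat \<Rightarrow> nat) \<Rightarrow> (nat \<Rightarrow> nat) \<Rightarrow> nat \<Rightarrow> nat \<Rightarrow> nat \<Rightarrow> nat"
  where
  "reduct_family X a b q j = (if j = 0 then subcode (to_union X a) (pfst q)
     else subcode (to_union X (subcode (to_union X b) (j - 1))) (component (psnd q) (j - 1)))"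

definition reduct :: "'a pspace \<Rightarrow> nat \<Rightarrow> (nat \<Rightarrow> nat) \<Rightarrow> (nat \<Rightarrow> nat) \<Rightarrow> nat \<Rightarrow> nat" where
  "reduct X e a b i = (if i = 0 then 1
     else finite_union X (pfst (pfst (i - 1)) + e) (reduct_family X a b (pfst (i - 1))) (psnd (i - 1)))"

lemma subcode_reduct:
  "subcode (reduct X e a b) q = finite_union X (pfst q + e) (reduct_family X a b q)"
  by (auto simp: subcode_def reduct_def)

locale effective_space =
  fixes X :: "'a pspace"
  assumes dense_seq_in: "range (dense_seq X) \<subseteq> points X"
    and dense_seq_dense:
      "\<And>x e. x \<in> points X \<Longrightarrow> 0 < e \<Longrightarrow> \<exists>i. mdist (metric_of X) (dense_seq X i) x < e"
    and decidable_dist_less: "\<And>i j m k. computable i \<Longrightarrow> computable j \<Longrightarrow> computable m \<Longrightarrow> computable k \<Longrightarrow>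
      decidable (\<lambda>x. mdist (metric_of X) (dense_seq X (i x)) (dense_seq X (j x))
        < real (m x) / (real (k x) + 1))"
begin

lemma dense_seq_points: "dense_seq X i \<in> points X"
  using dense_seq_in by blast

lemmas mem_nbhd = mem_nbhd_iff[OF dense_seq_in]

lemma ex_near: "x \<in> points X \<Longrightarrow> 0 < e \<Longrightarrow>
  \<exists>j t. mdist (metric_of X) (dense_seq X j) x < 1 / (real t + 1) \<and> 1 / (real t + 1) < e"
  using dense_seq_dense nat_approx_posE[of e]
  by (smt (verit, best) of_nat_0_le_iff of_nat_Suc zero_less_divide_1_iff add.commute)

lemma far_ball_iff:
  assumes x: "x \<in> points X"
  defines "d \<equiv> mdist (metric_of X)"
  shows "(\<exists>j t. q + 1 / (real t + 1) \<le> d (dense_seq X i) (dense_seq X j) \<and>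
      d (dense_seq X j) x < 1 / (real t + 1)) \<longleftrightarrow> q < d (dense_seq X i) x"
proof
  interpret Metric_space "points X" d
    by (simp add: d_def)
  note r = dense_seq_points
  show "q < d (dense_seq X i) x"
    if "\<exists>j t. q + 1 / (real t + 1) \<le> d (dense_seq X i) (dense_seq X j) \<and>
      d (dense_seq X j) x < 1 / (real t + 1)"
    using that triangle[OF r x r] by (smt (verit) commute)
  assume "q < d (dense_seq X i) x"
  then obtain j t where "d (dense_seq X j) x < 1 / (real t + 1)"
    "1 / (real t + 1) < (d (dense_seq X i) x - q) / 2"
    using ex_near[OF x, of "(d (dense_seq X i) x - q) / 2"] unfolding d_def by auto
  moreover have "d (dense_seq X i) x \<le> d (dense_seq X i) (dense_seq X j) + d (dense_seq X j) x"
    by (rule triangle[OF r r x])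
  ultimately have "q + 1 / (real t + 1) \<le> d (dense_seq X i) (dense_seq X j) \<and>
      d (dense_seq X j) x < 1 / (real t + 1)"
    by argo
  then show "\<exists>j t. q + 1 / (real t + 1) \<le> d (dense_seq X i) (dense_seq X j) \<and>
      d (dense_seq X j) x < 1 / (real t + 1)"
    by blast
qed

lemma far_radius:
  assumes "0 < m"
  shows "real ((m * Suc p - 1) * Suc t + Suc k * Suc p) / (real (Suc k * Suc p * Suc t - 1) + 1) =
    (real m / (real k + 1) - 1 / ((real k + 1) * (real p + 1))) + 1 / (real t + 1)"
proof -
  have "real (m * Suc p - 1) = real m * (real p + 1) - 1"
    using assms by (subst of_nat_diff) (auto simp: Suc_le_eq algebra_simps)
  then have "real ((m * Suc p - 1) * Suc t + Suc k * Suc p) =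
      (real m * (real p + 1) - 1) * (real t + 1) + (real k + 1) * (real p + 1)"
    unfolding of_nat_add of_nat_mult of_nat_Suc by (simp add: add.commute)
  moreover have "real (Suc k * Suc p * Suc t - 1) + 1 = (real k + 1) * (real p + 1) * (real t + 1)"
    by (subst of_nat_diff) (auto simp: algebra_simps)
  moreover have "((a * b - 1) * c + d * b) / (d * b * c) = (a / d - 1 / (d * b)) + 1 / c"
    if "b > 0" "c > 0" "d > 0" for a b c d :: real
    using that by (simp add: field_simps)
  ultimately show ?thesis
    by simp
qed

lemma mem_shell: "x \<in> coded_open X (shell_code X v p) \<longleftrightarrow>
  (\<exists>j t. far X v p (prod_encode (j, t)) \<and> x \<in> points X \<and>
    mdist (metric_of X) (dense_seq X j) x < 1 / (real t + 1))"
  (is "?L \<longleftrightarrow> ?R")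
proof
  assume ?L
  then obtain n where "far X v p n" "x \<in> nbhd X (prod_encode (pfst n, prod_encode (1, psnd n)))"
    unfolding mem_coded_open shell_code_def by (auto split: if_splits)
  then show ?R
    unfolding mem_nbhd by (intro exI[of _ "pfst n"] exI[of _ "psnd n"]) auto
next
  assume ?R
  then obtain j t where *: "far X v p (prod_encode (j, t))"
    "x \<in> nbhd X (prod_encode (j, prod_encode (1, t)))"
    unfolding mem_nbhd by auto
  then show ?L
    unfolding mem_coded_open shell_code_def
    by (intro exI[of _ "prod_encode (j, t)"] exI[of _ "prod_encode (j, prod_encode (1, t))"]) simp
qed

lemma coded_open_eq_Union_shells:
  "coded_open X c = (\<Union>n. points X - coded_open X (shell_code X (c (Suc (pfst n))) (psnd n)))"
proof -
  have "(\<exists>s. v = Suc s \<and> x \<in> nbhd X s) \<longleftrightarrow>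
      (\<exists>p. x \<notin> coded_open X (shell_code X v p))" if x: "x \<in> points X" for x v
  proof (cases v)
    case 0
    then show ?thesis
      using ex_near[OF x, of 1] x by (auto simp: mem_shell far_def)
  next
    case (Suc s)
    obtain i m k where s: "s = prod_encode (i, prod_encode (m, k))"
      by (metis prod.exhaust prod_decode_inverse)
    define d where "d = mdist (metric_of X) (dense_seq X i) x"
    have d: "0 \<le> d"
      unfolding d_def by simp
    show ?thesis
    proof (cases "m = 0")
      case True
      then have "far X v p u" for p u
        by (simp add: far_def s Suc)
      then have "x \<in> coded_open X (shell_code X v p)" for p
        using ex_near[OF x, of 1] x by (auto simp: mem_shell)
      moreover have "x \<notin> nbhd X s"
        by (simp add: s mem_nbhd True not_less)
      ultimately show ?thesis
        by (simp add: Suc)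
    next
      case False
      let ?q = "\<lambda>p. real m / (real k + 1) - 1 / ((real k + 1) * (real p + 1))"
      from False have "0 < m"
        by simp
      have "far X v p (prod_encode (j, t)) \<longleftrightarrow>
          ?q p + 1 / (real t + 1) \<le> mdist (metric_of X) (dense_seq X i) (dense_seq X j)" for p j t
        unfolding far_def Let_def Suc s diff_Suc_1 prod_encode_inverse fst_conv snd_conv
          far_radius[OF \<open>0 < m\<close>]
        using False by (simp add: not_less)
      then have "x \<in> coded_open X (shell_code X v p) \<longleftrightarrow> ?q p < d" for p
        unfolding d_def far_ball_iff[OF x, symmetric] mem_shell
        using x by simp
      moreover have "d < real m / (real k + 1) \<longleftrightarrow> (\<exists>p. d \<le> ?q p)"
      proof
        assume "d < real m / (real k + 1)"
        then obtain p where "1 / real (Suc p) < real m / (real k + 1) - d"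
          using nat_approx_posE[of "real m / (real k + 1) - d"] by auto
        moreover have "1 / ((real k + 1) * (real p + 1)) \<le> 1 / real (Suc p)"
          by (rule frac_le) (simp_all add: distrib_right)
        ultimately show "\<exists>p. d \<le> ?q p"
          by (intro exI[of _ p]) argo
      next
        assume "\<exists>p. d \<le> ?q p"
        moreover have "0 < 1 / ((real k + 1) * (real p + 1))" for p
          by simp
        ultimately show "d < real m / (real k + 1)"
          by (smt (verit))
      qed
      ultimately show ?thesis
        using x by (simp add: Suc s mem_nbhd d_def not_less)
    qed
  qed
  note * = this
  show ?thesis
  proof (intro set_eqI iffI)
    fix x assume "x \<in> coded_open X c"
    then obtain n s where n: "c (Suc n) = Suc s" "x \<in> nbhd X s"
      unfolding mem_coded_open by blast
    from n(2) have x: "x \<in> points X"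
      by (rule subsetD[OF nbhd_subset_points])
    from *[OF x, of "c (Suc n)"] n obtain p where "x \<notin> coded_open X (shell_code X (c (Suc n)) p)"
      by blast
    then show "x \<in> (\<Union>n. points X - coded_open X (shell_code X (c (Suc (pfst n))) (psnd n)))"
      using x by (intro UN_I[of "prod_encode (n, p)"]) auto
  next
    fix x assume "x \<in> (\<Union>n. points X - coded_open X (shell_code X (c (Suc (pfst n))) (psnd n)))"
    then obtain n where "x \<in> points X" "x \<notin> coded_open X (shell_code X (c (Suc (pfst n))) (psnd n))"
      by blast
    with *[of x "c (Suc (pfst n))"] show "x \<in> coded_open X c"
      unfolding mem_coded_open by blast
  qed
qed

lemma borel_code_to_union:
  assumes c: "borel_code X \<beta> c P" and \<beta>: "1 < \<beta>"
  shows "\<exists>Q. P = (\<Union>n. points X - Q n) \<and>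
    (\<forall>n. \<exists>\<gamma><\<beta>. borel_code X \<gamma> (subcode (to_union X c) n) (Q n))"
proof (cases "c 0 = 0")
  case True
  then have "P = (\<Union>n. points X - coded_open X (subcode (to_union X c) n))"
    unfolding borel_code_open_eq[OF c True]
    by (subst coded_open_eq_Union_shells) (simp add: subcode_to_union True)
  moreover have "borel_code X 1 (subcode (to_union X c) n)
      (coded_open X (subcode (to_union X c) n))" for n
    by (rule borel_code_coded_open) (simp_all add: True subcode_to_union shell_code_def)
  ultimately show ?thesis
    by (intro exI[of _ "\<lambda>n. coded_open X (subcode (to_union X c) n)"] conjI allI exI[of _ 1] \<beta>)
next
  case False
  then have "subcode (to_union X c) n = subcode c n" for n
    by (simp add: subcode_to_union)
  then show ?thesis
    using borel_code_union_cases[OF c False] by metis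
qed

lemma borel_code_finite_union:
  assumes D: "\<And>j. j \<le> n \<Longrightarrow> borel_code X \<beta> (D j) (R j)"
  shows "borel_code X \<beta> (finite_union X n D) (\<Union>j\<le>n. R j)"
proof (cases "\<forall>j\<le>n. D j 0 = 0")
  case True
  have "(\<Union>j\<le>n. R j) = (\<Union>j\<le>n. coded_open X (D j))"
    using D borel_code_open_eq True by fastforce
  also have "\<dots> = coded_open X (finite_union X n D)"
  proof (intro set_eqI iffI)
    fix x assume "x \<in> (\<Union>j\<le>n. coded_open X (D j))"
    then obtain j u s where "j \<le> n" "D j (Suc u) = Suc s" "x \<in> nbhd X s"
      unfolding mem_coded_open UN_iff by blast
    then show "x \<in> coded_open X (finite_union X n D)"
      unfolding mem_coded_open using True
      by (intro exI[of _ "prod_encode (j, u)"] exI[of _ s]) (simp add: finite_union_def)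
  next
    fix x assume "x \<in> coded_open X (finite_union X n D)"
    then obtain u s where "D (min (pfst u) n) (Suc (psnd u)) = Suc s" "x \<in> nbhd X s"
      unfolding mem_coded_open using True by (auto simp: finite_union_def)
    then show "x \<in> (\<Union>j\<le>n. coded_open X (D j))"
      unfolding mem_coded_open UN_iff by (intro bexI[of _ "min (pfst u) n"]) auto
  qed
  finally show ?thesis
    using borel_code_rank_pos[OF D] True
    by (metis borel_code_coded_open finite_union_def order_refl)
next
  case False
  then have \<beta>: "1 < \<beta>"
    using borel_code_union_cases D by blast
  have "\<forall>j\<in>{..n}. \<exists>Q. R j = (\<Union>k. points X - Q k) \<and>
      (\<forall>k. \<exists>\<gamma><\<beta>. borel_code X \<gamma> (subcode (to_union X (D j)) k) (Q k))"
    by (intro ballI borel_code_to_union[OF D \<beta>]) simp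
  from bchoice[OF this] obtain Q where "\<forall>j\<in>{..n}. R j = (\<Union>k. points X - Q j k) \<and>
      (\<forall>k. \<exists>\<gamma><\<beta>. borel_code X \<gamma> (subcode (to_union X (D j)) k) (Q j k))"
    by (elim exE)
  then have R: "\<And>j. j \<le> n \<Longrightarrow> R j = (\<Union>k. points X - Q j k)"
    and Q: "\<And>j k. j \<le> n \<Longrightarrow> \<exists>\<gamma><\<beta>. borel_code X \<gamma> (subcode (to_union X (D j)) k) (Q j k)"
    by simp_all
  have eq: "(\<Union>j\<le>n. R j) = (\<Union>p. points X - Q (min (pfst p) n) (psnd p))"
  proof (intro set_eqI iffI)
    fix x assume "x \<in> (\<Union>j\<le>n. R j)"
    then obtain j k where "j \<le> n" "x \<in> points X - Q j k"
      using R by blast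
    then show "x \<in> (\<Union>p. points X - Q (min (pfst p) n) (psnd p))"
      by (intro UN_I[of "prod_encode (j, k)"]) auto
  next
    fix x assume "x \<in> (\<Union>p. points X - Q (min (pfst p) n) (psnd p))"
    then obtain p where "x \<in> points X - Q (min (pfst p) n) (psnd p)"
      by blast
    then have "x \<in> R (min (pfst p) n)"
      using R[of "min (pfst p) n"] by auto
    then show "x \<in> (\<Union>j\<le>n. R j)"
      by (intro UN_I[of "min (pfst p) n"]) auto
  qed
  have "subcode (finite_union X n D) p =
      subcode (to_union X (D (min (pfst p) n))) (psnd p)" for p
    unfolding subcode_def finite_union_def if_not_P[OF False] by simp
  then have "\<exists>\<gamma><\<beta>. borel_code X \<gamma> (subcode (finite_union X n D) p) (Q (min (pfst p) n) (psnd p))" for p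
    using Q[of "min (pfst p) n" "psnd p"] by simp
  moreover have "finite_union X n D 0 = 1"
    unfolding finite_union_def if_not_P[OF False] by simp
  ultimately show ?thesis
    unfolding eq by (intro union_compl[OF \<beta>])
qed

lemma borel_code_finite_union_less:
  assumes "\<And>j. j \<le> n \<Longrightarrow> \<exists>\<beta><\<xi>. borel_code X \<beta> (D j) (R j)"
  shows "\<exists>\<beta><\<xi>. borel_code X \<beta> (finite_union X n D) (\<Union>j\<le>n. R j)"
proof -
  obtain \<beta> where \<beta>: "\<And>j. j \<le> n \<Longrightarrow> \<beta> j < \<xi> \<and> borel_code X (\<beta> j) (D j) (R j)"
    using assms by metis
  define \<gamma> where "\<gamma> = Max (\<beta> ` {..n})"
  have "\<gamma> < \<xi>"
    unfolding \<gamma>_def using \<beta> by (subst Max_less_iff) auto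
  moreover have "borel_code X \<gamma> (D j) (R j)" if "j \<le> n" for j
    by (rule borel_code_mono[of X "\<beta> j"]) (use that \<beta> in \<open>auto simp: \<gamma>_def\<close>)
  ultimately show ?thesis
    using borel_code_finite_union by blast
qed

lemma borel_code_reduct:
  assumes \<xi>: "1 < \<xi>"
    and a: "\<And>n. \<exists>\<beta><\<xi>. borel_code X \<beta> (subcode (to_union X a) n) (P n)"
    and b: "\<And>n. \<exists>\<beta><\<xi>. borel_code X \<beta> (subcode (to_union X b) n) (Q n)"
  shows "borel_code X \<xi> (reduct X e a b) {x \<in> points X. \<exists>n. x \<notin> P n \<and> (\<forall>m<n+e. x \<in> Q m)}"
proof -
  have "\<exists>R. Q m = (\<Union>k. points X - R k) \<and> (\<forall>k. \<exists>\<gamma><\<xi>.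
      borel_code X \<gamma> (subcode (to_union X (subcode (to_union X b) m)) k) (R k))" for m
  proof -
    obtain \<beta> where \<beta>: "\<beta> < \<xi>" "borel_code X \<beta> (subcode (to_union X b) m) (Q m)"
      using b by blast
    from borel_code_to_union[OF borel_code_mono[OF this(2)] \<xi>] \<beta>(1) show ?thesis
      by (simp add: order_less_imp_le)
  qed
  then obtain R where Q: "\<And>m. Q m = (\<Union>k. points X - R m k)" and R: "\<And>m k. \<exists>\<gamma><\<xi>.
      borel_code X \<gamma> (subcode (to_union X (subcode (to_union X b) m)) k) (R m k)"
    by metis
  define S where "S q j = (if j = 0 then P (pfst q) else R (j - 1) (component (psnd q) (j - 1)))"
    for q j
  have "\<exists>\<beta><\<xi>. borel_code X \<beta> (reduct_family X a b q j) (S q j)" for q j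
    unfolding reduct_family_def S_def using a R by auto
  then have "\<exists>\<beta><\<xi>. borel_code X \<beta> (subcode (reduct X e a b) q) (\<Union>j\<le>pfst q + e. S q j)" for q
    unfolding subcode_reduct by (intro borel_code_finite_union_less)
  then have "borel_code X \<xi> (reduct X e a b) (\<Union>q. points X - (\<Union>j\<le>pfst q + e. S q j))"
    by (intro union_compl \<xi>) (auto simp: reduct_def)
  also have "(\<Union>q. points X - (\<Union>j\<le>pfst q + e. S q j)) =
      {x \<in> points X. \<exists>n. x \<notin> P n \<and> (\<forall>m<n+e. x \<in> Q m)}"
  proof (intro set_eqI iffI)
    fix x assume "x \<in> (\<Union>q. points X - (\<Union>j\<le>pfst q + e. S q j))"
    then obtain q where x: "x \<in> points X" and q: "\<And>j. j \<le> pfst q + e \<Longrightarrow> x \<notin> S q j"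
      by blast
    have "x \<notin> P (pfst q)"
      using q[of 0] by (simp add: S_def)
    moreover have "x \<in> Q m" if "m < pfst q + e" for m
      using q[of "Suc m"] that x unfolding Q by (auto simp: S_def)
    ultimately show "x \<in> {x \<in> points X. \<exists>n. x \<notin> P n \<and> (\<forall>m<n+e. x \<in> Q m)}"
      using x by blast
  next
    fix x assume "x \<in> {x \<in> points X. \<exists>n. x \<notin> P n \<and> (\<forall>m<n+e. x \<in> Q m)}"
    then obtain n where x: "x \<in> points X" "x \<notin> P n" and n: "\<And>m. m < n + e \<Longrightarrow> x \<in> Q m"
      by blast
    from n have "\<forall>m. \<exists>k. m < n + e \<longrightarrow> x \<notin> R m k"
      unfolding Q by blast
    then obtain s where s: "\<And>m. m < n + e \<Longrightarrow> x \<notin> R m (s m)"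
      by metis
    obtain k where k: "\<And>m. m < n + e \<Longrightarrow> component k m = s m"
      using ex_components by blast
    have "x \<notin> S (prod_encode (n, k)) j" if "j \<le> n + e" for j
      using x(2) s k that by (cases j) (auto simp: S_def)
    then show "x \<in> (\<Union>q. points X - (\<Union>j\<le>pfst q + e. S q j))"
      using x(1) by (intro UN_I[of "prod_encode (n, k)"]) auto
  qed
  finally show ?thesis .
qed

lemma computable_to_union:
  assumes D: "computable2 D"
  shows "computable2 (\<lambda>e. to_union X (D e))"
  unfolding computable2_def to_union_def shell_code_def far_def Let_def
  by (intro computable_intros computable2_app[OF D] decidable_dist_less)

lemma computable_finite_union:
  assumes D: "computable3 D" and N: "computable N"
  shows "computable2 (\<lambda>e. finite_union X (N e) (D e))"
proof -
  have "computable2 (\<lambda>z. D (pfst z) (psnd z))"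
    unfolding computable2_def by (intro computable_intros computable3_app[OF D])
  from computable2_app[OF computable_to_union[OF this]]
  have *: "computable (\<lambda>x. to_union X (D (f x) (g x)) (h x))"
    if "computable f" "computable g" "computable h" for f g h
    using that computable_prod_encode[of f g] by fastforce
  show ?thesis
    unfolding computable2_def finite_union_def min_def
    by (intro computable_intros * computable3_app[OF D] computable_comp[OF N] decidable_all_le,
        unfold decidable2_def)
       (intro computable_intros * computable3_app[OF D] computable_comp[OF N])
qed

lemma computable_reduct:
  assumes a: "computable a" and b: "computable b"
  shows "computable (reduct X e a b)"
proof -
  have *: "computable (\<lambda>x. to_union X c (f x))" if "computable c" "computable f" for c f
    by (rule computable2_app[OF computable_to_union computable_id that(2)])
       (simp add: computable2_def computable_comp[OF that(1) computable_psnd[OF computable_id]])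
  have "computable2 (\<lambda>j. subcode (to_union X b) j)"
    unfolding computable2_def subcode_def by (intro computable_intros * b)
  note ** = computable2_app[OF computable_to_union[OF this]]
  have "computable2 component"
    unfolding computable2_def component_def
    by (intro computable_intros computable_rec_nat, unfold computable3_def)
       (intro computable_intros)
  note *** = computable2_app[OF this]
  have "computable3 (reduct_family X a b)"
    unfolding computable3_def reduct_family_def if_distribR
    unfolding subcode_def
    by (intro computable_intros * a **[unfolded subcode_def] ***)
  from computable_finite_union[OF this, of "\<lambda>q. pfst q + e"]
  have "computable2 (\<lambda>q. finite_union X (pfst q + e) (reduct_family X a b q))"
    by (simp add: computable_intros)
  note **** = computable2_app[OF this]
  show ?thesis
    unfolding reduct_def by (intro computable_intros ****)
qed

end

section \<open>Cylinders\<close>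

lemma psnd_le: "psnd p \<le> p"
  by (metis le_prod_encode_2 prod.collapse prod_decode_inverse)

lemma psnd_less_Suc [termination_simp]: "psnd p < Suc p"
  using psnd_le by (rule le_imp_less_Suc)

text \<open>In the code of a cylinder, entry \<open>i\<close> is obtained from entry \<open>cyl_pos i\<close> of the given code and,
  if this entry enumerates a neighborhood, from the dense point of the second factor with index
  \<open>cyl_index i\<close>. Both maps strip a spurious second component from every branching
  \<open>Suc (prod_encode (n, m))\<close> on the path to \<open>i\<close>; \<open>cyl_index\<close> returns the last one stripped, so that the
  transformation commutes with passing to subcodes.\<close>

fun cyl_pos :: "nat \<Rightarrow> nat" where
  "cyl_pos 0 = 0"
| "cyl_pos (Suc p) = Suc (prod_encode (pfst (pfst p), cyl_pos (psnd p)))"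

fun cyl_index :: "nat \<Rightarrow> nat" where
  "cyl_index 0 = 0"
| "cyl_index (Suc p) = (if psnd p = 0 then psnd (pfst p) else cyl_index (psnd p))"

text \<open>An entry \<open>1\<close> is left unchanged, whether it marks a union node or enumerates the neighborhood
  with index \<open>0\<close>: in the latter case the neighborhood has radius \<open>0\<close> and is empty in any space.\<close>

definition cylinder_code :: "(nat \<Rightarrow> nat) \<Rightarrow> nat \<Rightarrow> nat" where
  "cylinder_code c i = (let v = c (cyl_pos i) in if v \<le> 1 then v
     else Suc (prod_encode (prod_encode (pfst (v - 1), cyl_index i), psnd (v - 1))))"

lemma computable_cylinder_code:
  assumes "computable c"
  shows "computable (cylinder_code c)"
proof -
  have pos: "computable cyl_pos"
    by (rule computable_descent[where g = psnd and
          h = "\<lambda>p y. Suc (prod_encode (pfst (pfst p), y))", unfolded computable2_def])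
       (auto simp: psnd_le intro!: computable_intros)
  have index: "computable cyl_index"
    by (rule computable_descent[where g = psnd and
          h = "\<lambda>p y. if psnd p = 0 then psnd (pfst p) else y", unfolded computable2_def])
       (auto simp: psnd_le intro!: computable_intros)
  show ?thesis
    unfolding cylinder_code_def Let_def
    by (intro computable_intros computable_comp[OF assms] pos index)
qed

lemma ex_cyl_pos_index: "\<exists>p. cyl_pos (Suc p) = Suc n \<and> cyl_index (Suc p) = j"
proof (induction n rule: less_induct)
  case (less n)
  obtain a b where n: "n = prod_encode (a, b)"
    by (metis prod.exhaust prod_decode_inverse)
  show ?case
  proof (cases b)
    case 0
    then show ?thesis
      by (intro exI[of _ "prod_encode (prod_encode (a, j), 0)"]) (simp add: n)
  next
    case (Suc b')
    have "b' < n"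
      using le_prod_encode_2[of b a] Suc n by simp
    from less[OF this] obtain p where "cyl_pos (Suc p) = b" "cyl_index (Suc p) = j"
      using Suc by blast
    then show ?thesis
      by (intro exI[of _ "prod_encode (prod_encode (a, 0), Suc p)"])
         (simp add: n del: cyl_pos.simps(2) cyl_index.simps(2) add: cyl_pos.simps(2)[of "prod_encode _"]
           cyl_index.simps(2)[of "prod_encode _"])
  qed
qed

lemma subcode_cylinder_code:
  assumes "subcode c (pfst n) 0 \<le> 1"
  shows "subcode (cylinder_code c) n = cylinder_code (subcode c (pfst n))"
proof
  fix m
  have "cyl_index (Suc (prod_encode (n, m))) = cyl_index m" if "m \<noteq> 0"
    using that by simp
  then show "subcode (cylinder_code c) n m = cylinder_code (subcode c (pfst n)) m"
    using assms by (cases "m = 0") (auto simp: subcode_def cylinder_code_def Let_def)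
qed

lemma dense_seq_prod [simp]:
  "dense_seq (prod_pspace X Y) (prod_encode (i, j)) = (dense_seq X i, dense_seq Y j)"
  by (simp add: prod_pspace_def)

lemma dense_seq_prod_decode:
  "dense_seq (prod_pspace X Y) s = (dense_seq X (pfst s), dense_seq Y (psnd s))"
  by (simp add: prod_pspace_def split_beta)

lemma effective_space_recursively_presented:
  assumes "recursively_presented X"
  shows "effective_space X"
proof
  show "range (dense_seq X) \<subseteq> points X"
    using assms by (simp add: recursively_presented_def)
  interpret Metric_space "points X" "mdist (metric_of X)"
    by simp
  show "\<exists>i. mdist (metric_of X) (dense_seq X i) x < e" if x: "x \<in> points X" and "0 < e" for x e
  proof -
    have "x \<in> mtopology closure_of range (dense_seq X)"
      using assms x by (simp add: recursively_presented_def mtopology_of_def)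
    then show ?thesis
      using \<open>0 < e\<close> unfolding metric_closure_of by (auto simp: commute)
  qed
  define R where "R = (\<lambda>xs. mdist (metric_of X) (dense_seq X (xs ! 0)) (dense_seq X (xs ! 1))
       < real (xs ! 2) / (real (xs ! 3) + 1))"
  have "recursive_on 4 (\<lambda>xs. if R xs then 1 else 0)"
    using assms by (simp add: recursively_presented_def computable_rel_def recursive_on_def R_def)
  moreover have "4 = Suc (Suc (Suc (Suc 0)))"
    by simp
  ultimately have R: "recursive_on (Suc (Suc (Suc (Suc 0)))) (\<lambda>xs. if R xs then 1 else 0)"
    by metis
  show "decidable (\<lambda>x. mdist (metric_of X) (dense_seq X (i x)) (dense_seq X (j x))
      < real (m x) / (real (k x) + 1))"
    if "computable i" "computable j" "computable m" "computable k" for i j m k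
  proof -
    have "recursive_on (Suc 0) (\<lambda>xs. if R [i (xs ! 0), j (xs ! 0), m (xs ! 0), k (xs ! 0)] then 1 else 0)"
      using recursive_on_map[of "map (\<lambda>f xs. f (xs ! 0)) [i, j, m, k]" _ "Suc 0", simplified,
          OF R] that
      by (simp add: computable_iff_recursive_on)
    then show ?thesis
      by (simp add: decidable_def computable_iff_recursive_on of_bool_def R_def eval_nat_numeral)
  qed
qed

lemma nbhd_zero: "nbhd X 0 = {}"
proof -
  have "prod_decode 0 = (0, 0)"
    by (simp add: prod_decode_diagonal)
  then show ?thesis
    by (simp add: nbhd_def in_mball_of set_eq_iff not_less)
qed

lemma range_dense_seq_prod:
  "range (dense_seq X) \<subseteq> points X \<Longrightarrow> range (dense_seq Y) \<subseteq> points Y \<Longrightarrow>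
    range (dense_seq (prod_pspace X Y)) \<subseteq> points (prod_pspace X Y)"
  by (auto simp: dense_seq_prod_decode)

lemma borel_code_cylinder:
  assumes Y: "effective_space Y" and X: "range (dense_seq X) \<subseteq> points X"
  assumes "borel_code X \<beta> c P"
  shows "borel_code (prod_pspace X Y) \<beta> (cylinder_code c) (P \<times> points Y)"
  using assms(3)
proof (induction rule: borel_code.induct)
  case (open_code c)
  interpret Y: effective_space Y by fact
  note mem_prod = mem_nbhd_iff[OF range_dense_seq_prod[OF X Y.dense_seq_in]]
  have "coded_open X c \<times> points Y = coded_open (prod_pspace X Y) (cylinder_code c)"
  proof (intro set_eqI iffI)
    fix z assume "z \<in> coded_open X c \<times> points Y"
    then obtain x y n s where z: "z = (x, y)" and y: "y \<in> points Y"
      and n: "c (Suc n) = Suc s" "x \<in> nbhd X s"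
      by (auto simp: mem_coded_open)
    obtain i m k where s: "s = prod_encode (i, prod_encode (m, k))"
      by (metis prod.exhaust prod_decode_inverse)
    have "s \<noteq> 0"
      using n(2) nbhd_zero by (metis empty_iff)
    have x: "x \<in> points X" "mdist (metric_of X) (dense_seq X i) x < real m / (real k + 1)"
      using n(2) by (simp_all add: s mem_nbhd_iff[OF X])
    have "0 < real m / (real k + 1)"
      using x(2) by (rule le_less_trans[rotated]) simp
    from Y.dense_seq_dense[OF y this] obtain j
      where j: "mdist (metric_of Y) (dense_seq Y j) y < real m / (real k + 1)"
      by blast
    obtain p where "cyl_pos (Suc p) = Suc n" "cyl_index (Suc p) = j"
      using ex_cyl_pos_index by blast
    then have "cylinder_code c (Suc p) = Suc (prod_encode (prod_encode (i, j), prod_encode (m, k)))"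
      using n(1) \<open>s \<noteq> 0\<close> unfolding cylinder_code_def by (simp add: Let_def s)
    moreover have "z \<in> nbhd (prod_pspace X Y) (prod_encode (prod_encode (i, j), prod_encode (m, k)))"
      using x j y unfolding mem_prod by (simp add: z max_dist_def)
    ultimately show "z \<in> coded_open (prod_pspace X Y) (cylinder_code c)"
      unfolding mem_coded_open by blast
  next
    fix z assume "z \<in> coded_open (prod_pspace X Y) (cylinder_code c)"
    then obtain p s where p: "cylinder_code c (Suc p) = Suc s" and z: "z \<in> nbhd (prod_pspace X Y) s"
      unfolding mem_coded_open by blast
    from z have "s \<noteq> 0"
      using nbhd_zero by (metis empty_iff)
    define n where "n = prod_encode (pfst (pfst p), cyl_pos (psnd p))"
    obtain i m k where v: "c (Suc n) - 1 = prod_encode (i, prod_encode (m, k))"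
      by (metis prod.exhaust prod_decode_inverse)
    have c: "c (Suc n) = Suc (prod_encode (i, prod_encode (m, k)))"
      and s: "s = prod_encode (prod_encode (i, cyl_index (Suc p)), prod_encode (m, k))"
      using p v \<open>s \<noteq> 0\<close> unfolding cylinder_code_def
      by (auto simp: Let_def n_def[symmetric] simp del: cyl_index.simps split: if_splits)
    have "fst z \<in> nbhd X (prod_encode (i, prod_encode (m, k)))" "snd z \<in> points Y"
      using z unfolding s mem_prod
      by (auto simp: max_dist_def mem_nbhd_iff[OF X] simp del: cyl_index.simps)
    with c show "z \<in> coded_open X c \<times> points Y"
      unfolding mem_Times_iff mem_coded_open by blast
  qed
  moreover have "cylinder_code c 0 = 0"
    using open_code by (simp add: cylinder_code_def)
  ultimately show ?case
    unfolding coded_open_def[symmetric] by (simp add: borel_code_coded_open)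
next
  case (weaken \<beta> c P \<alpha>)
  then show ?case
    by (blast intro: borel_code.weaken)
next
  case (union_compl \<alpha> c P)
  have "subcode c n 0 \<le> 1" for n
    using union_compl.IH[of n] borel_code_union_cases[of X _ "subcode c n" "P n"]
    by (cases "subcode c n 0 = 0") auto
  then have "\<exists>\<beta><\<alpha>. borel_code (prod_pspace X Y) \<beta> (subcode (cylinder_code c) n)
      (P (pfst n) \<times> points Y)" for n
    using union_compl.IH[of "pfst n"] by (auto simp: subcode_cylinder_code)
  then have "borel_code (prod_pspace X Y) \<alpha> (cylinder_code c)
      (\<Union>n. points (prod_pspace X Y) - P (pfst n) \<times> points Y)"
    using union_compl.hyps by (intro borel_code.union_compl) (auto simp: cylinder_code_def)
  moreover have "(\<Union>n. points X - P n) \<times> points Y =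
      (\<Union>n. points (prod_pspace X Y) - P (pfst n) \<times> points Y)"
  proof -
    have "\<exists>q. n = pfst q" for n
      by (metis fst_conv prod_encode_inverse)
    then show ?thesis
      by auto (metis (no_types))
  qed
  ultimately show ?case by simp
qed

section \<open>Baire space and products\<close>

lemma baire_dist_less_iff:
  "baire_dist x y < real m / (real k + 1) \<longleftrightarrow>
    0 < m \<and> (\<forall>l\<le>k. m * Suc l \<le> Suc k \<longrightarrow> x l = y l)"
proof (cases "x = y")
  case True
  then show ?thesis by (auto simp: baire_dist_def zero_less_divide_iff)
next
  case False
  define d where "d = (LEAST n. x n \<noteq> y n)"
  have d: "x d \<noteq> y d"
    unfolding d_def by (rule LeastI_ex) (use False in auto)
  have d_le: "x l \<noteq> y l \<Longrightarrow> d \<le> l" for l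
    unfolding d_def by (rule Least_le)
  have "baire_dist x y < real m / (real k + 1) \<longleftrightarrow> real (Suc k) < real (m * Suc d)"
    using False unfolding baire_dist_def d_def[symmetric] by (simp add: field_simps)
  also have "\<dots> \<longleftrightarrow> Suc k < m * Suc d"
    by (rule of_nat_less_iff)
  also have "\<dots> \<longleftrightarrow> 0 < m \<and> (\<forall>l\<le>k. m * Suc l \<le> Suc k \<longrightarrow> x l = y l)"
  proof (intro iffI conjI allI impI)
    assume less: "Suc k < m * Suc d"
    then show "0 < m" by (cases m) auto
    fix l assume "m * Suc l \<le> Suc k"
    from this less have "m * Suc l < m * Suc d"
      by (rule le_less_trans)
    then show "x l = y l"
      using d_le by (meson Suc_le_mono mult_le_mono2 not_less)
  next
    assume *: "0 < m \<and> (\<forall>l\<le>k. m * Suc l \<le> Suc k \<longrightarrow> x l = y l)"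
    then have "k < d" if "m * Suc d \<le> Suc k"
      using d that by (meson not_le)
    moreover have "Suc d \<le> m * Suc d"
      using * mult_le_mono1[of 1 m "Suc d"] by auto
    ultimately show "Suc k < m * Suc d"
      by (meson Suc_less_eq le_less_trans not_le order_less_irrefl order_trans)
  qed
  finally show ?thesis .
qed

lemma computable_dense_seq_baire: "computable2 (dense_seq baire)"
proof -
  define tail where "tail i n = rec_nat i (\<lambda>_ z. if z = 0 then 0 else psnd (z - 1)) n" for i n
  have tail_Suc: "tail i (Suc n) = tail (if i = 0 then 0 else psnd (i - 1)) n" for i n
    by (induction n) (simp_all add: tail_def)
  have tail_0: "tail i 0 = i" for i
    by (simp add: tail_def)
  have tail_nil: "tail 0 n = 0" for n
    by (induction n) (simp_all add: tail_def)
  have "dense_seq baire (list_encode xs) n =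
      (if tail (list_encode xs) n = 0 then 0 else pfst (tail (list_encode xs) n - 1))" for xs n
  proof (induction xs arbitrary: n)
    case Nil
    then show ?case by (simp add: baire_def tail_nil)
  next
    case (Cons x xs)
    show ?case
    proof (cases n)
      case 0
      then show ?thesis by (simp add: baire_def tail_0)
    next
      case (Suc n')
      have "dense_seq baire (list_encode (x # xs)) (Suc n') = dense_seq baire (list_encode xs) n'"
        by (simp add: baire_def)
      then show ?thesis
        using Suc by (simp add: Cons.IH tail_Suc)
    qed
  qed
  then have "dense_seq baire i n = (if tail i n = 0 then 0 else pfst (tail i n - 1))" for i n
    by (metis list_decode_inverse)
  then have *: "dense_seq baire = (\<lambda>i n. if tail i n = 0 then 0 else pfst (tail i n - 1))"
    by blast
  have "computable2 tail"
    unfolding computable2_def tail_def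
    by (intro computable_intros computable_rec_nat, unfold computable3_def)
       (intro computable_intros)
  note tail = computable2_app[OF this]
  show ?thesis
    unfolding computable2_def * by (intro computable_intros tail)
qed

lemma effective_space_baire: "effective_space baire"
proof
  show "range (dense_seq baire) \<subseteq> points baire"
    by simp
  show "\<exists>i. mdist (metric_of baire) (dense_seq baire i) x < e" if e: "0 < e" for x and e :: real
  proof -
    obtain k where k: "1 / real (Suc k) < e"
      using nat_approx_posE[OF e] by blast
    have "baire_dist (dense_seq baire (list_encode (map x [0..<Suc k]))) x < real 1 / (real k + 1)"
      unfolding baire_dist_less_iff by (auto simp: baire_def nth_append simp del: upt_Suc)
    with k show ?thesis
      by (intro exI[of _ "list_encode (map x [0..<Suc k])"]) (simp add: add.commute)
  qed
  note d = computable2_app[OF computable_dense_seq_baire]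
  show "decidable (\<lambda>x. mdist (metric_of baire) (dense_seq baire (i x)) (dense_seq baire (j x))
      < real (m x) / (real (k x) + 1))"
    if "computable i" "computable j" "computable m" "computable k" for i j m k
    unfolding mdist_baire baire_dist_less_iff
    by (intro computable_intros decidable_all_le that, unfold decidable2_def)
       (intro computable_intros d computable_comp[OF that(1)] computable_comp[OF that(2)]
          computable_comp[OF that(3)] computable_comp[OF that(4)])
qed

lemma effective_space_prod:
  assumes "effective_space X" "effective_space Y"
  shows "effective_space (prod_pspace X Y)"
proof
  interpret X: effective_space X by fact
  interpret Y: effective_space Y by fact
  show "range (dense_seq (prod_pspace X Y)) \<subseteq> points (prod_pspace X Y)"
    by (rule range_dense_seq_prod[OF X.dense_seq_in Y.dense_seq_in])
  show "\<exists>i. mdist (metric_of (prod_pspace X Y)) (dense_seq (prod_pspace X Y) i) z < e"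
    if z: "z \<in> points (prod_pspace X Y)" and e: "0 < e" for z and e :: real
  proof -
    have "fst z \<in> points X" "snd z \<in> points Y"
      using z by auto
    with e obtain i j where "mdist (metric_of X) (dense_seq X i) (fst z) < e"
      "mdist (metric_of Y) (dense_seq Y j) (snd z) < e"
      using X.dense_seq_dense Y.dense_seq_dense by metis
    then show ?thesis
      by (intro exI[of _ "prod_encode (i, j)"]) (simp add: max_dist_def)
  qed
  show "decidable (\<lambda>x. mdist (metric_of (prod_pspace X Y)) (dense_seq (prod_pspace X Y) (i x))
      (dense_seq (prod_pspace X Y) (j x)) < real (m x) / (real (k x) + 1))"
    if "computable i" "computable j" "computable m" "computable k" for i j m k
    unfolding mdist_prod_pspace max_dist_def dense_seq_prod_decode fst_conv snd_conv max_less_iff_conj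
    by (intro decidable_conj X.decidable_dist_less Y.decidable_dist_less computable_pfst
        computable_psnd that)
qed

section \<open>Reduction\<close>

lemma one_less_one_plus:
  assumes "0 < \<alpha>"
  shows "(1::cord) < 1 + \<alpha>"
  using assms
proof transfer
  fix s :: "nat rel"
  assume s: "(s, s) \<in> ordIso" and pos: "({} :: nat rel, s) \<in> ordLess"
  let ?one = "{(0, 0)} :: nat rel"
  let ?t = "wo_sum ?one s"
  have wo: "Well_order s" "Well_order ?one"
    using s by (auto simp: ordIso_def order_on_defs refl_on_def Field_def trans_def antisym_def)
  have t: "Well_order ?t"
    by (rule Well_order_wo_sum[OF wo(2,1)])
  have one: "Field ?one = {0}"
    by (simp add: Field_def)
  obtain b where b: "b \<in> Field s"
  proof -
    have "s \<noteq> {}"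
      using pos ordLess_irreflexive by blast
    then show ?thesis
      using that by (auto simp: Field_def)
  qed
  have "\<not> (?t, ?one) \<in> ordLeq"
  proof
    assume "(?t, ?one) \<in> ordLeq"
    then obtain h where "embed ?t ?one h"
      by (auto simp: ordLeq_def)
    then have inj: "inj_on h (Field ?t)" and "h ` Field ?t \<subseteq> Field ?one"
      using embed_inj_on[OF t] embed_Field by blast+
    then have h: "h x = 0" if "x \<in> Field ?t" for x
      using that unfolding one by blast
    have "sum_encode (Inl 0) \<in> Field ?t" "sum_encode (Inr b) \<in> Field ?t"
      using b one by (simp_all add: Field_wo_sum_iff)
    with h have "sum_encode (Inl 0) = sum_encode (Inr b)"
      using inj_onD[OF inj] by metis
    then show False
      by (simp add: sum_encode_eq)
  qed
  then show "(?one, ?t) \<in> ordLess"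
    using not_ordLeq_iff_ordLess[OF wo(2) t] by simp
qed

lemma (in effective_space) Sigma0_cover_reduction:
  assumes \<xi>: "1 < \<xi>" and A: "A \<in> Sigma0 X \<xi>" and B: "B \<in> Sigma0 X \<xi>" and cover: "A \<union> B = points X"
  shows "\<exists>D\<in>Delta0 X \<xi>. D \<subseteq> A \<and> points X - D \<subseteq> B"
proof -
  obtain a b where a: "computable a" "borel_code X \<xi> a A" and b: "computable b" "borel_code X \<xi> b B"
    using A B by (auto simp: Sigma0_def)
  obtain P where P: "A = (\<Union>n. points X - P n)"
    "\<And>n. \<exists>\<gamma><\<xi>. borel_code X \<gamma> (subcode (to_union X a) n) (P n)"
    using borel_code_to_union[OF a(2) \<xi>] by blast
  obtain Q where Q: "B = (\<Union>n. points X - Q n)"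
    "\<And>n. \<exists>\<gamma><\<xi>. borel_code X \<gamma> (subcode (to_union X b) n) (Q n)"
    using borel_code_to_union[OF b(2) \<xi>] by blast
  define D where "D = {x \<in> points X. \<exists>n. x \<notin> P n \<and> (\<forall>m<n+0. x \<in> Q m)}"
  define E where "E = {x \<in> points X. \<exists>n. x \<notin> Q n \<and> (\<forall>m<n+1. x \<in> P m)}"
  have "D \<in> Sigma0 X \<xi>" "E \<in> Sigma0 X \<xi>"
    unfolding Sigma0_def D_def E_def
    using borel_code_reduct[OF \<xi> P(2) Q(2), of 0] borel_code_reduct[OF \<xi> Q(2) P(2), of 1]
      computable_reduct[OF a(1) b(1)] computable_reduct[OF b(1) a(1)] by blast+
  moreover have "D = points X - E"
  proof (intro set_eqI iffI)
    fix x assume "x \<in> D"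
    then obtain n where "x \<in> points X" "x \<notin> P n" "\<forall>m<n. x \<in> Q m"
      unfolding D_def by auto
    moreover have "n < Suc k \<or> k < n" for k
      by auto
    ultimately show "x \<in> points X - E"
      unfolding E_def by auto
  next
    fix x assume x: "x \<in> points X - E"
    then have E: "\<exists>m\<le>n. x \<notin> P m" if "x \<notin> Q n" for n
      using that unfolding E_def by (auto simp: less_Suc_eq_le)
    have ex: "\<exists>n. x \<notin> P n"
      using x cover E unfolding P(1) Q(1) by blast
    define n where "n = (LEAST n. x \<notin> P n)"
    have "x \<notin> P n"
      unfolding n_def by (rule LeastI_ex[OF ex])
    moreover have "x \<in> Q m" if "m < n" for m
      using E[of m] that not_less_Least[of _ "\<lambda>n. x \<notin> P n"] unfolding n_def[symmetric]
      by (meson le_less_trans)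
    ultimately show "x \<in> D"
      using x unfolding D_def by auto
  qed
  ultimately have "D \<in> Delta0 X \<xi>"
    unfolding Delta0_def Pi0_def by blast
  moreover have "D \<subseteq> A"
    unfolding D_def P(1) by blast
  moreover have "points X - D \<subseteq> B"
    using \<open>D = points X - E\<close> unfolding E_def Q(1) by blast
  ultimately show ?thesis by blast
qed

lemma (in effective_space) Sigma0_Un:
  assumes A: "A \<in> Sigma0 X \<xi>" and B: "B \<in> Sigma0 X \<xi>"
  shows "A \<union> B \<in> Sigma0 X \<xi>"
proof -
  obtain a b where a: "computable a" "borel_code X \<xi> a A" and b: "computable b" "borel_code X \<xi> b B"
    using A B by (auto simp: Sigma0_def)
  define D where "D = (\<lambda>(_ :: nat) (j :: nat). if j = 0 then a else b)"
  define R where "R = (\<lambda>j :: nat. if j = 0 then A else B)"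
  have "borel_code X \<xi> (finite_union X 1 (D 0)) (\<Union>j\<le>1. R j)"
    by (rule borel_code_finite_union) (use a b in \<open>auto simp: D_def R_def\<close>)
  moreover have "(\<Union>j\<le>1. R j) = A \<union> B"
    unfolding atMost_Suc One_nat_def atMost_0 by (auto simp: R_def)
  moreover have "computable3 D"
    unfolding computable3_def D_def if_distribR
    by (intro computable_intros computable_comp[OF a(1)] computable_comp[OF b(1)])
  from computable2_app[OF computable_finite_union[OF this computable_const] computable_const computable_id]
  have "computable (finite_union X 1 (D 0))" .
  ultimately show ?thesis
    unfolding Sigma0_def by auto
qed

theorem theorem33:
  fixes \<alpha> :: cord and f :: "nat \<Rightarrow> nat"
  assumes "computable_ordinal \<alpha>" and "0 < \<alpha>"
    and "Pi0_singleton (1 + \<alpha>) f"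
  shows "\<forall>X :: 'a pspace. recursively_presented X \<longrightarrow> strongly_relativizes_Delta0_at f (1 + \<alpha>) X"
proof (intro allI impI)
  fix X :: "'a pspace"
  assume "recursively_presented X"
  then have X: "effective_space X"
    by (rule effective_space_recursively_presented)
  let ?Z = "prod_pspace baire X" and ?\<xi> = "1 + \<alpha>"
  interpret Z: effective_space ?Z
    by (intro effective_space_prod effective_space_baire X)
  obtain S where S: "S \<in> Sigma0 baire ?\<xi>" "{f} = UNIV - S"
    using assms(3) by (auto simp: Pi0_singleton_def Pi0_def)
  then obtain c where "computable c" "borel_code baire ?\<xi> c S"
    by (auto simp: Sigma0_def)
  then have cyl: "S \<times> points X \<in> Sigma0 ?Z ?\<xi>"
    unfolding Sigma0_def using borel_code_cylinder[OF X] computable_cylinder_code by force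
  show "strongly_relativizes_Delta0_at f ?\<xi> X"
    unfolding strongly_relativizes_Delta0_at_def
  proof
    fix P assume "P \<in> Delta0_in f X ?\<xi>"
    then obtain A B where A: "A \<in> Sigma0 ?Z ?\<xi>" and B: "B \<in> Sigma0 ?Z ?\<xi>"
      and PA: "P = section_at f A" and PB: "P = section_at f (points ?Z - B)"
      by (auto simp: Delta0_in_def Sigma0_in_def Pi0_in_def Pi0_def)
    have sub: "A \<subseteq> points ?Z" "B \<subseteq> points ?Z"
      using A B Sigma0_subset_points by blast+
    have f: "f \<notin> S" and others: "\<And>g. g \<noteq> f \<Longrightarrow> g \<in> S"
      using S(2) by auto
    have P: "x \<in> P \<longleftrightarrow> (f, x) \<in> A" "x \<in> P \<longleftrightarrow> x \<in> points X \<and> (f, x) \<notin> B" for x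
      using PA PB by (auto simp: section_at_def)
    have "(A \<union> S \<times> points X) \<union> (B \<union> S \<times> points X) = points ?Z"
    proof
      show "points ?Z \<subseteq> (A \<union> S \<times> points X) \<union> (B \<union> S \<times> points X)"
      proof
        fix z assume "z \<in> points ?Z"
        then obtain g x where z: "z = (g, x)" "x \<in> points X"
          by auto
        then show "z \<in> (A \<union> S \<times> points X) \<union> (B \<union> S \<times> points X)"
          using P[of x] others[of g] by (cases "g = f") auto
      qed
    qed (use sub in auto)
    from Z.Sigma0_cover_reduction[OF one_less_one_plus[OF assms(2)]
        Z.Sigma0_Un[OF A cyl] Z.Sigma0_Un[OF B cyl] this]
    obtain D where D: "D \<in> Delta0 ?Z ?\<xi>" "D \<subseteq> A \<union> S \<times> points X"
      "points ?Z - D \<subseteq> B \<union> S \<times> points X"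
      by blast
    have "(f, x) \<in> D \<longleftrightarrow> x \<in> P" for x
    proof
      show "(f, x) \<in> D \<Longrightarrow> x \<in> P"
        using D(2) f P(1) by auto
      show "x \<in> P \<Longrightarrow> (f, x) \<in> D"
        using D(3) f P(2)[of x] by auto
    qed
    then show "\<exists>Q\<in>Delta0 ?Z ?\<xi>. P = section_at f Q"
      using D(1) by (auto simp: section_at_def)
  qed
qed

end
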